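(* Let $R$ be a Noetherian ring, $M$ a finitely generated $R$-module, and $\{M_{\underline n}\mid \underline n\in\mathbb Z^t\}$ a Noetherian filtration of $M$. Then: (1) there exists $k\in\mathbb N$ such that for all $\underline m\in\mathbb Z^t$, all $\underline n\in\mathbb N^t$ and all ideals $J\subseteq R$, \[ J^{k|\underline n|}M_{\underline m}\cap\big(M_{\underline m+\underline n}:_{M_{\underline m}}J^{\infty}\big)\subseteq M_{\underline m+\underline n}, \] i.e. $\big(J^{k|\underline n|}M_{\underline m}+M_{\underline m+\underline n}\big)\cap\big(M_{\underline m+\underline n}:_{M_{\underline m}}J^{\infty}\big)=M_{\underline m+\underline n}$; (2) the set $\bigcup_{\underline m\in\mathbb Z^t,\ \underline n\in\mathbb N^t}\operatorname{Ass}(M_{\underline m}/M_{\underline m+\underline n})$ is finite.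
   Context: For $\underline n=(n_1,\dots,n_t)$, $|\underline n|=n_1+\cdots+n_t$ and $\mathbb N^t=\{\underline n: n_i\ge 0\}$. A family $\{M_{\underline n}\mid\underline n\in\mathbb Z^t\}$ of $R$-submodules of $M$ is a Noetherian filtration of $M$ if there is a $\mathbb Z^t$-graded subring $\mathcal R$ of $R[T_1,\dots,T_t,T_1^{-1},\dots,T_t^{-1}]$ (usual multigrading) containing $T_1^{-1},\dots,T_t^{-1}$ and whose degree-$(0,\dots,0)$ part is $R$, such that $\mathcal M=\bigoplus_{\underline n\in\mathbb Z^t}M_{\underline n}T_1^{n_1}\cdots T_t^{n_t}\subseteq M[T_1^{\pm1},\dots,T_t^{\pm1}]$ is an $\mathcal R$-submodule and is a Noetherian $\mathcal R$-module. For submodules $N\subseteq L$ and an ideal $J$, $(N:_L J^{\infty})=\bigcup_{i\ge0}\{x\in L: J^ix\subseteq N\}$. *)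

theory Defs
  imports "HOL.Modules"
begin

definition is_ideal :: "'r::comm_ring_1 set \<Rightarrow> bool" where
  "is_ideal I \<longleftrightarrow> 0 \<in> I \<and> (\<forall>a\<in>I. \<forall>b\<in>I. a + b \<in> I) \<and> (\<forall>r. \<forall>a\<in>I. r * a \<in> I)"

definition ideal_gen :: "'r::comm_ring_1 set \<Rightarrow> 'r set" where
  "ideal_gen S = \<Inter>{I. is_ideal I \<and> S \<subseteq> I}"

definition noetherian_ring :: "'r::comm_ring_1 itself \<Rightarrow> bool" where
  "noetherian_ring _ \<longleftrightarrow>
     (\<forall>I::'r set. is_ideal I \<longrightarrow> (\<exists>S. finite S \<and> I = ideal_gen S))"

definition prime_ideal :: "'r::comm_ring_1 set \<Rightarrow> bool" where
  "prime_ideal P \<longleftrightarrow> is_ideal P \<and> P \<noteq> UNIV \<and> (\<forall>a b. a * b \<in> P \<longrightarrow> a \<in> P \<or> b \<in> P)"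

definition ideal_mult :: "'r::comm_ring_1 set \<Rightarrow> 'r set \<Rightarrow> 'r set" where
  "ideal_mult I J = ideal_gen {a * b | a b. a \<in> I \<and> b \<in> J}"

primrec ideal_pow :: "'r::comm_ring_1 set \<Rightarrow> nat \<Rightarrow> 'r set" where
  "ideal_pow J 0 = UNIV"
| "ideal_pow J (Suc k) = ideal_mult (ideal_pow J k) J"

definition fin_gen_module :: "('r::comm_ring_1 \<Rightarrow> 'm::ab_group_add \<Rightarrow> 'm) \<Rightarrow> bool" where
  "fin_gen_module scale \<longleftrightarrow> (\<exists>S. finite S \<and> module.span scale S = UNIV)"

definition ideal_smult :: "('r::comm_ring_1 \<Rightarrow> 'm::ab_group_add \<Rightarrow> 'm) \<Rightarrow> 'r set \<Rightarrow> 'm set \<Rightarrow> 'm set" where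
  "ideal_smult scale J N = module.span scale {scale r x | r x. r \<in> J \<and> x \<in> N}"

definition sat_colon :: "('r::comm_ring_1 \<Rightarrow> 'm::ab_group_add \<Rightarrow> 'm) \<Rightarrow> 'm set \<Rightarrow> 'm set \<Rightarrow> 'r set \<Rightarrow> 'm set" where
  "sat_colon scale N L J = (\<Union>i. {x \<in> L. \<forall>r \<in> ideal_pow J i. scale r x \<in> N})"

definition Ass_quot :: "('r::comm_ring_1 \<Rightarrow> 'm::ab_group_add \<Rightarrow> 'm) \<Rightarrow> 'm set \<Rightarrow> 'm set \<Rightarrow> 'r set set" where
  "Ass_quot scale L N = {P. prime_ideal P \<and> (\<exists>x\<in>L. P = {r. scale r x \<in> N})}"

definition vadd :: "('t \<Rightarrow> int) \<Rightarrow> ('t \<Rightarrow> int) \<Rightarrow> ('t \<Rightarrow> int)" where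
  "vadd m n = (\<lambda>i. m i + n i)"

definition vsub :: "('t \<Rightarrow> int) \<Rightarrow> ('t \<Rightarrow> int) \<Rightarrow> ('t \<Rightarrow> int)" where
  "vsub m n = (\<lambda>i. m i - n i)"

definition vnorm :: "('t::finite \<Rightarrow> int) \<Rightarrow> int" where
  "vnorm n = (\<Sum>i\<in>UNIV. n i)"

definition in_Nt :: "('t \<Rightarrow> int) \<Rightarrow> bool" where
  "in_Nt n \<longleftrightarrow> (\<forall>i. 0 \<le> n i)"

text \<open>The multidegree of T_i^{-1}: minus the i-th unit vector.\<close>
definition neg_unit :: "'t \<Rightarrow> ('t \<Rightarrow> int)" where
  "neg_unit i = (\<lambda>j. if j = i then -1 else 0)"

text \<open>A Z^t-graded subring \<R> of R[T^{\<pm>1}] with degree-0 part R containing all T_i^{-1}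
  is determined by its homogeneous components \<R>_d = I d \<cdot> T^d, where I d \<subseteq> R.
  \<R> = \<Oplus> I d T^d is a subring iff each I d is an additive subgroup, 1 \<in> I 0 and
  I d \<cdot> I e \<subseteq> I (d+e).\<close>
definition graded_rees_ring :: "(('t::finite \<Rightarrow> int) \<Rightarrow> 'r::comm_ring_1 set) \<Rightarrow> bool" where
  "graded_rees_ring I \<longleftrightarrow>
     (\<forall>d. 0 \<in> I d \<and> (\<forall>a\<in>I d. \<forall>b\<in>I d. a + b \<in> I d \<and> - a \<in> I d)) \<and>
     (\<forall>d e. \<forall>a\<in>I d. \<forall>b\<in>I e. a * b \<in> I (vadd d e)) \<and>
     I (\<lambda>_. 0) = UNIV \<and>
     (\<forall>i. 1 \<in> I (neg_unit i))"

text \<open>Elements of \<M> = \<Oplus> M_n T^n: finitely supported f with f n \<in> M_n.\<close>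
definition rees_mod_elems :: "(('t \<Rightarrow> int) \<Rightarrow> 'm::ab_group_add set) \<Rightarrow> (('t \<Rightarrow> int) \<Rightarrow> 'm) set" where
  "rees_mod_elems Mf = {f. finite {n. f n \<noteq> 0} \<and> (\<forall>n. f n \<in> Mf n)}"

text \<open>Multiplication of f by the homogeneous element a T^d.\<close>
definition hom_smult :: "('r \<Rightarrow> 'm \<Rightarrow> 'm) \<Rightarrow> 'r \<Rightarrow> ('t \<Rightarrow> int) \<Rightarrow> (('t \<Rightarrow> int) \<Rightarrow> 'm) \<Rightarrow> (('t \<Rightarrow> int) \<Rightarrow> 'm)" where
  "hom_smult scale a d f = (\<lambda>n. scale a (f (vsub n d)))"

text \<open>\<R>-submodules of \<M>. Since \<R> is additively generated by its homogeneous
  elements, closure under + and under multiplication by homogeneous elements of \<R>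
  is closure under \<R>.\<close>
definition rees_submod ::
  "('r::comm_ring_1 \<Rightarrow> 'm::ab_group_add \<Rightarrow> 'm) \<Rightarrow> (('t::finite \<Rightarrow> int) \<Rightarrow> 'r set) \<Rightarrow> (('t \<Rightarrow> int) \<Rightarrow> 'm set)
     \<Rightarrow> (('t \<Rightarrow> int) \<Rightarrow> 'm) set \<Rightarrow> bool" where
  "rees_submod scale I Mf N \<longleftrightarrow>
     N \<subseteq> rees_mod_elems Mf \<and> (\<lambda>_. 0) \<in> N \<and> (\<forall>f\<in>N. \<forall>g\<in>N. (\<lambda>n. f n + g n) \<in> N) \<and>
     (\<forall>d. \<forall>a\<in>I d. \<forall>f\<in>N. hom_smult scale a d f \<in> N)"

definition rees_span ::
  "('r::comm_ring_1 \<Rightarrow> 'm::ab_group_add \<Rightarrow> 'm) \<Rightarrow> (('t::finite \<Rightarrow> int) \<Rightarrow> 'r set) \<Rightarrow> (('t \<Rightarrow> int) \<Rightarrow> 'm set)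
     \<Rightarrow> (('t \<Rightarrow> int) \<Rightarrow> 'm) set \<Rightarrow> (('t \<Rightarrow> int) \<Rightarrow> 'm) set" where
  "rees_span scale I Mf G = \<Inter>{N. rees_submod scale I Mf N \<and> G \<subseteq> N}"

definition noetherian_filtration ::
  "('r::comm_ring_1 \<Rightarrow> 'm::ab_group_add \<Rightarrow> 'm) \<Rightarrow> (('t::finite \<Rightarrow> int) \<Rightarrow> 'm set) \<Rightarrow> bool" where
  "noetherian_filtration scale Mf \<longleftrightarrow>
     (\<forall>n. module.subspace scale (Mf n)) \<and>
     (\<exists>I. graded_rees_ring I \<and>
          (\<forall>d n. \<forall>a\<in>I d. \<forall>x\<in>Mf n. scale a x \<in> Mf (vadd d n)) \<and>
          (\<forall>N. rees_submod scale I Mf N \<longrightarrow>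
               (\<exists>G. finite G \<and> G \<subseteq> N \<and> rees_span scale I Mf G = N)))"

end

theory Submission
  imports Defs "HOL-Library.Function_Algebras"
begin

text \<open>
  Write \<open>A = \<Oplus> M\<^sub>n T\<^sup>n\<close> and \<open>x\<^sub>i = T\<^sub>i\<^sup>-\<^sup>1\<close>, which acts injectively on \<open>A\<close>; then \<open>M\<^sub>m / M\<^sub>m\<^sub>+\<^sub>n\<close> is the
  component of degree \<open>m\<close> of \<open>A / x\<^sup>n A\<close>. Each \<open>x\<^sub>i A\<close> is a finite intersection of submodules \<open>Q\<close> that
  are primary with respect to \<open>R\<close>, and by cancelling the \<open>x\<^sub>i\<close> one at a time every prime of \<open>R\<close>
  associated to \<open>A / x\<^sup>n A\<close> is the radical of one of these \<open>Q\<close>, which gives (2).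

  For (1), let \<open>J'\<close> be the intersection of those of these finitely many radicals that contain \<open>J\<close>.
  Then \<open>J \<subseteq> J'\<close> and \<open>(x\<^sup>n A : J\<^sup>\<infinity>) \<subseteq> (x\<^sup>n A : J'\<^sup>\<infinity>)\<close>, so only finitely many ideals matter.
  For a fixed ideal \<open>J\<close> there are constants \<open>e\<close> with \<open>J\<^sup>e A \<inter> (x\<^sub>i A : J\<^sup>\<infinity>) \<subseteq> x\<^sub>i A\<close>, from the primary
  decomposition, and \<open>c\<close> with \<open>J\<^sup>a A \<inter> x\<^sub>i A \<subseteq> J\<^bsup>a-c\<^esup> x\<^sub>i A\<close>, by Artin--Rees. Hence \<open>k = c + e\<close> works, by
  induction on the number of factors \<open>x\<^sub>i\<close>. Since \<open>\<R>\<close> enters only through the operators by which its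
  homogeneous elements act, the argument applies to abelian groups with commuting operators.
\<close>

section \<open>Groups with operators and Hilbert's basis theorem\<close>

definition submod :: "('c \<Rightarrow> 'c) set \<Rightarrow> 'c::ab_group_add set \<Rightarrow> bool" where
  "submod \<Omega> N \<longleftrightarrow> 0 \<in> N \<and> (\<forall>x\<in>N. \<forall>y\<in>N. x - y \<in> N) \<and> (\<forall>f\<in>\<Omega>. \<forall>x\<in>N. f x \<in> N)"

text \<open>The condition is put on ascending sequences because the basis theorem and the
  Artin--Rees lemma both feed it explicit chains indexed by natural numbers.\<close>

definition noetherian :: "('c \<Rightarrow> 'c) set \<Rightarrow> 'c::ab_group_add set \<Rightarrow> bool" where
  "noetherian \<Omega> A \<longleftrightarrow> submod \<Omega> A \<and>
     (\<forall>F::nat \<Rightarrow> 'c set. (\<forall>i. submod \<Omega> (F i) \<and> F i \<subseteq> A) \<longrightarrow> mono F \<longrightarrow> (\<exists>k. \<forall>i\<ge>k. F i = F k))"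

lemma submodI:
  assumes "0 \<in> N" "\<And>x y. x \<in> N \<Longrightarrow> y \<in> N \<Longrightarrow> x - y \<in> N" "\<And>f x. f \<in> \<Omega> \<Longrightarrow> x \<in> N \<Longrightarrow> f x \<in> N"
  shows "submod \<Omega> N"
  using assms by (auto simp: submod_def)

lemma submod_zero: "submod \<Omega> N \<Longrightarrow> 0 \<in> N"
  and submod_diff: "submod \<Omega> N \<Longrightarrow> x \<in> N \<Longrightarrow> y \<in> N \<Longrightarrow> x - y \<in> N"
  and submod_op: "submod \<Omega> N \<Longrightarrow> f \<in> \<Omega> \<Longrightarrow> x \<in> N \<Longrightarrow> f x \<in> N"
  by (auto simp: submod_def)

lemma submod_minus: "submod \<Omega> N \<Longrightarrow> x \<in> N \<Longrightarrow> - x \<in> N"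
  using submod_diff[of \<Omega> N 0 x] submod_zero by force

lemma submod_add: "submod \<Omega> N \<Longrightarrow> x \<in> N \<Longrightarrow> y \<in> N \<Longrightarrow> x + y \<in> N"
  using submod_diff[of \<Omega> N x "- y"] submod_minus by force

lemma submod_Inter: "(\<And>N. N \<in> \<N> \<Longrightarrow> submod \<Omega> N) \<Longrightarrow> submod \<Omega> (\<Inter>\<N>)"
  by (auto simp: submod_def)

lemma submod_Int: "submod \<Omega> M \<Longrightarrow> submod \<Omega> N \<Longrightarrow> submod \<Omega> (M \<inter> N)"
  by (auto simp: submod_def)

lemma noetherian_submod: "noetherian \<Omega> A \<Longrightarrow> submod \<Omega> A"
  by (simp add: noetherian_def)

lemma noetherian_chain:
  assumes "noetherian \<Omega> A" "\<And>i. submod \<Omega> (F i)" "\<And>i. F i \<subseteq> A" "\<And>i. F i \<subseteq> F (Suc i)"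
  obtains k where "\<And>i. i \<ge> k \<Longrightarrow> F i = F k"
proof -
  have "mono F"
    using assms(4) by (simp add: mono_iff_le_Suc)
  then have "\<exists>k. \<forall>i\<ge>k. F i = F k"
    using assms(1,2,3) unfolding noetherian_def by blast
  then show thesis
    using that by blast
qed

text \<open>A counterexample always has a strictly larger counterexample above it, so dependent
  choice would produce a strictly increasing chain.\<close>

lemma noetherian_induct [consumes 3, case_names step]:
  assumes A: "noetherian \<Omega> A" and "submod \<Omega> N" "N \<subseteq> A"
    and step: "\<And>N. submod \<Omega> N \<Longrightarrow> N \<subseteq> A \<Longrightarrow>
                 (\<And>N'. submod \<Omega> N' \<Longrightarrow> N' \<subseteq> A \<Longrightarrow> N \<subset> N' \<Longrightarrow> P N') \<Longrightarrow> P N"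
  shows "P N"
proof (rule ccontr)
  assume "\<not> P N"
  define bad where "bad K \<longleftrightarrow> submod \<Omega> K \<and> K \<subseteq> A \<and> \<not> P K" for K
  have "bad N"
    using assms \<open>\<not> P N\<close> by (simp add: bad_def)
  moreover have "\<exists>K'. bad K' \<and> K \<subset> K'" if "bad K" for K
    using that step[of K] unfolding bad_def by blast
  ultimately obtain F where F: "\<And>i::nat. bad (F i)" "\<And>i. F i \<subset> F (Suc i)"
    using dependent_nat_choice[of "\<lambda>_. bad" "\<lambda>_ K K'. K \<subset> K'"] by metis
  obtain k where k: "\<And>i. i \<ge> k \<Longrightarrow> F i = F k"
    by (rule noetherian_chain[OF A, of F]) (use F in \<open>auto simp: bad_def psubset_eq\<close>)
  show False
    using F(2)[of k] k[of "Suc k"] by auto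
qed

section \<open>Polynomials in one additive operator, and their leading coefficients\<close>

lemma additive_funpow:
  fixes \<theta> :: "'c::ab_group_add \<Rightarrow> 'c"
  assumes "additive \<theta>"
  shows "additive (\<theta> ^^ n)"
proof (induction n)
  case (Suc n)
  then show ?case
    using assms by (auto simp: additive_def)
qed (simp add: additive_def)

definition poly_val :: "('c \<Rightarrow> 'c::ab_group_add) \<Rightarrow> nat \<Rightarrow> (nat \<Rightarrow> 'c) \<Rightarrow> 'c" where
  "poly_val \<theta> d g = (\<Sum>b<d. (\<theta> ^^ b) (g b))"

definition adjoin :: "('c \<Rightarrow> 'c::ab_group_add) \<Rightarrow> 'c set \<Rightarrow> 'c set" where
  "adjoin \<theta> A = {poly_val \<theta> d g | d g. \<forall>b. g b \<in> A}"

text \<open>Degrees are formal: an element may be written as a polynomial in \<theta> in several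
  ways, and the coefficient at d of every representation of length d + 1 counts, zero
  included.\<close>

definition lead_coeffs :: "('c \<Rightarrow> 'c::ab_group_add) \<Rightarrow> 'c set \<Rightarrow> nat \<Rightarrow> 'c set \<Rightarrow> 'c set" where
  "lead_coeffs \<theta> A d N = {g d | g. (\<forall>b. g b \<in> A) \<and> poly_val \<theta> (Suc d) g \<in> N}"

lemma poly_val_diff:
  "additive \<theta> \<Longrightarrow> poly_val \<theta> d (\<lambda>b. g b - h b) = poly_val \<theta> d g - poly_val \<theta> d h"
  unfolding poly_val_def
  by (simp add: sum_subtractf additive.diff[OF additive_funpow])

lemma poly_val_commute:
  assumes "additive f" "\<And>x. f (\<theta> x) = \<theta> (f x)"
  shows "poly_val \<theta> d (\<lambda>b. f (g b)) = f (poly_val \<theta> d g)"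
proof -
  have "f ((\<theta> ^^ b) x) = (\<theta> ^^ b) (f x)" for b x
    by (induction b) (auto simp: assms(2))
  then show ?thesis
    unfolding poly_val_def by (simp add: additive.sum[OF assms(1)])
qed

lemma poly_val_shift:
  assumes "additive \<theta>"
  shows "poly_val \<theta> (Suc d) (\<lambda>b. case b of 0 \<Rightarrow> 0 | Suc b \<Rightarrow> g b) = \<theta> (poly_val \<theta> d g)"
  unfolding poly_val_def
  by (subst sum.lessThan_Suc_shift) (simp add: additive.sum[OF assms])

lemma poly_val_truncate:
  assumes "additive \<theta>" "d \<le> e"
  shows "poly_val \<theta> d g = poly_val \<theta> e (\<lambda>b. if b < d then g b else 0)"
proof -
  have "(\<theta> ^^ b) 0 = 0" for b
    using additive.zero[OF additive_funpow[OF assms(1)]] .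
  then show ?thesis
    unfolding poly_val_def using assms(2) by (intro sum.mono_neutral_cong_left) auto
qed

lemma subset_adjoin: "A \<subseteq> adjoin \<theta> A"
proof
  fix x assume "x \<in> A"
  then have "poly_val \<theta> (Suc 0) (\<lambda>_. x) \<in> adjoin \<theta> A"
    unfolding adjoin_def by blast
  then show "x \<in> adjoin \<theta> A"
    by (simp add: poly_val_def)
qed

lemma submod_adjoin:
  assumes A: "submod \<Omega> A" and ops: "\<And>f. f \<in> \<Omega> \<Longrightarrow> additive f"
    and add: "additive \<theta>" and comm: "\<And>f x. f \<in> \<Omega> \<Longrightarrow> f (\<theta> x) = \<theta> (f x)"
  shows "submod (insert \<theta> \<Omega>) (adjoin \<theta> A)"
proof (rule submodI)
  show "0 \<in> adjoin \<theta> A"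
    using subset_adjoin submod_zero[OF A] by blast
next
  fix x y assume "x \<in> adjoin \<theta> A" "y \<in> adjoin \<theta> A"
  then obtain d g e h where g: "x = poly_val \<theta> d g" "\<forall>b. g b \<in> A"
    and h: "y = poly_val \<theta> e h" "\<forall>b. h b \<in> A"
    unfolding adjoin_def by blast
  let ?m = "max d e"
  let ?g = "\<lambda>b. if b < d then g b else 0" and ?h = "\<lambda>b. if b < e then h b else 0"
  have "x - y = poly_val \<theta> ?m (\<lambda>b. ?g b - ?h b)"
    using poly_val_truncate[OF add, of d ?m g] poly_val_truncate[OF add, of e ?m h]
    by (simp add: g h poly_val_diff[OF add, of ?m ?g ?h])
  moreover have "\<forall>b. ?g b - ?h b \<in> A"
    using g h submod_diff[OF A] submod_zero[OF A] by simp
  ultimately show "x - y \<in> adjoin \<theta> A"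
    unfolding adjoin_def by blast
next
  fix f x assume f: "f \<in> insert \<theta> \<Omega>" and "x \<in> adjoin \<theta> A"
  then obtain d g where g: "x = poly_val \<theta> d g" "\<forall>b. g b \<in> A"
    unfolding adjoin_def by blast
  show "f x \<in> adjoin \<theta> A"
  proof (cases "f = \<theta>")
    case True
    have "\<forall>b. (case b of 0 \<Rightarrow> 0 | Suc b \<Rightarrow> g b) \<in> A"
      using g submod_zero[OF A] by (auto split: nat.split)
    then show ?thesis
      unfolding adjoin_def True g(1) poly_val_shift[OF add, symmetric] by blast
  next
    case False
    then have "f \<in> \<Omega>"
      using f by simp
    then have "f x = poly_val \<theta> d (\<lambda>b. f (g b))" "\<forall>b. f (g b) \<in> A"
      using g poly_val_commute[of f \<theta> d g] ops comm submod_op[OF A] by auto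
    then show ?thesis
      unfolding adjoin_def by blast
  qed
qed

lemma submod_lead_coeffs:
  assumes A: "submod \<Omega> A" and ops: "\<And>f. f \<in> \<Omega> \<Longrightarrow> additive f"
    and add: "additive \<theta>" and comm: "\<And>f x. f \<in> \<Omega> \<Longrightarrow> f (\<theta> x) = \<theta> (f x)"
    and N: "submod \<Omega> N"
  shows "submod \<Omega> (lead_coeffs \<theta> A d N)"
proof (rule submodI)
  have "poly_val \<theta> (Suc d) (\<lambda>_. 0) = 0"
    unfolding poly_val_def using additive.zero[OF additive_funpow[OF add]] by simp
  then show "0 \<in> lead_coeffs \<theta> A d N"
    unfolding lead_coeffs_def using submod_zero[OF A] submod_zero[OF N]
    by (auto intro!: exI[of _ "\<lambda>_. 0"])
next
  fix x y assume "x \<in> lead_coeffs \<theta> A d N" "y \<in> lead_coeffs \<theta> A d N"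
  then obtain g h where g: "x = g d" "\<forall>b. g b \<in> A" "poly_val \<theta> (Suc d) g \<in> N"
    and h: "y = h d" "\<forall>b. h b \<in> A" "poly_val \<theta> (Suc d) h \<in> N"
    unfolding lead_coeffs_def by blast
  have "poly_val \<theta> (Suc d) (\<lambda>b. g b - h b) \<in> N" "\<forall>b. g b - h b \<in> A"
    unfolding poly_val_diff[OF add] using g h submod_diff[OF N] submod_diff[OF A] by auto
  then show "x - y \<in> lead_coeffs \<theta> A d N"
    unfolding lead_coeffs_def g(1) h(1) by (auto intro!: exI[of _ "\<lambda>b. g b - h b"])
next
  fix f x assume f: "f \<in> \<Omega>" and "x \<in> lead_coeffs \<theta> A d N"
  then obtain g where g: "x = g d" "\<forall>b. g b \<in> A" "poly_val \<theta> (Suc d) g \<in> N"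
    unfolding lead_coeffs_def by blast
  have "poly_val \<theta> (Suc d) (\<lambda>b. f (g b)) \<in> N" "\<forall>b. f (g b) \<in> A"
    using g submod_op[OF N f] submod_op[OF A f] poly_val_commute[of f \<theta> "Suc d" g, OF ops[OF f] comm[OF f]]
    by auto
  then show "f x \<in> lead_coeffs \<theta> A d N"
    unfolding lead_coeffs_def g(1) by (auto intro!: exI[of _ "\<lambda>b. f (g b)"])
qed

lemma lead_coeffs_mono: "M \<subseteq> N \<Longrightarrow> lead_coeffs \<theta> A d M \<subseteq> lead_coeffs \<theta> A d N"
  unfolding lead_coeffs_def by blast

lemma lead_coeffs_subset: "lead_coeffs \<theta> A d N \<subseteq> A"
  unfolding lead_coeffs_def by blast

lemma lead_coeffs_Suc:
  assumes A: "submod \<Omega> A" and add: "additive \<theta>" and N: "\<And>x. x \<in> N \<Longrightarrow> \<theta> x \<in> N"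
  shows "lead_coeffs \<theta> A d N \<subseteq> lead_coeffs \<theta> A (Suc d) N"
proof
  fix x assume "x \<in> lead_coeffs \<theta> A d N"
  then obtain g where g: "x = g d" "\<forall>b. g b \<in> A" "poly_val \<theta> (Suc d) g \<in> N"
    unfolding lead_coeffs_def by blast
  let ?g = "\<lambda>b. case b of 0 \<Rightarrow> 0 | Suc b \<Rightarrow> g b"
  have "\<forall>b. ?g b \<in> A"
    using g submod_zero[OF A] by (auto split: nat.split)
  moreover have "poly_val \<theta> (Suc (Suc d)) ?g \<in> N"
    unfolding poly_val_shift[OF add] using N g(3) .
  ultimately show "x \<in> lead_coeffs \<theta> A (Suc d) N"
    unfolding lead_coeffs_def g(1) by (auto intro!: exI[of _ ?g])
qed

text \<open>Induction on the length of the polynomial: subtracting an element of M with the same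
  leading coefficient leaves an element of N with a shorter representation.\<close>

lemma submod_eq_if_lead_coeffs_eq:
  assumes A: "submod \<Omega> A" and add: "additive \<theta>"
    and M: "submod \<Omega> M" and N: "submod \<Omega> N" "N \<subseteq> adjoin \<theta> A" and "M \<subseteq> N"
    and eq: "\<And>d. lead_coeffs \<theta> A d N = lead_coeffs \<theta> A d M"
  shows "N = M"
proof -
  have "poly_val \<theta> d g \<in> M" if "\<forall>b. g b \<in> A" "poly_val \<theta> d g \<in> N" for d g
    using that
  proof (induction d arbitrary: g)
    case 0
    then show ?case
      using submod_zero[OF M] by (simp add: poly_val_def)
  next
    case (Suc d)
    have "g d \<in> lead_coeffs \<theta> A d N"
      unfolding lead_coeffs_def using Suc.prems by blast
    then have "g d \<in> lead_coeffs \<theta> A d M"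
      unfolding eq .
    then obtain h where h: "h d = g d" "\<forall>b. h b \<in> A" "poly_val \<theta> (Suc d) h \<in> M"
      unfolding lead_coeffs_def by force
    have "poly_val \<theta> (Suc d) g - poly_val \<theta> (Suc d) h = poly_val \<theta> d (\<lambda>b. g b - h b)"
      unfolding poly_val_diff[OF add] by (simp add: poly_val_def h(1))
    moreover from this have "poly_val \<theta> d (\<lambda>b. g b - h b) \<in> N"
      using submod_diff[OF N(1) Suc.prems(2), of "poly_val \<theta> (Suc d) h"] h(3) \<open>M \<subseteq> N\<close> by auto
    moreover have "\<forall>b. g b - h b \<in> A"
      using Suc.prems(1) h(2) submod_diff[OF A] by blast
    ultimately have "poly_val \<theta> (Suc d) g - poly_val \<theta> (Suc d) h \<in> M"
      using Suc.IH[of "\<lambda>b. g b - h b"] by simp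
    then show ?case
      using submod_add[OF M _ h(3)] by fastforce
  qed
  then show ?thesis
    using N(2) \<open>M \<subseteq> N\<close> unfolding adjoin_def by blast
qed

text \<open>Hilbert's basis theorem, for the image of \<open>A[X]\<close> under \<open>X \<mapsto> \<theta>\<close>: staying inside the type of
  \<open>A\<close> is what allows the step to be iterated over finitely many operators.\<close>

theorem noetherian_adjoin:
  assumes A: "noetherian \<Omega> A" and ops: "\<And>f. f \<in> \<Omega> \<Longrightarrow> additive f"
    and add: "additive \<theta>" and comm: "\<And>f x. f \<in> \<Omega> \<Longrightarrow> f (\<theta> x) = \<theta> (f x)"
  shows "noetherian (insert \<theta> \<Omega>) (adjoin \<theta> A)"
  unfolding noetherian_def
proof (intro conjI allI impI)
  note A' = noetherian_submod[OF A]
  show "submod (insert \<theta> \<Omega>) (adjoin \<theta> A)"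
    using submod_adjoin[OF A' ops add comm] .
  fix F :: "nat \<Rightarrow> 'a set"
  assume F: "\<forall>i. submod (insert \<theta> \<Omega>) (F i) \<and> F i \<subseteq> adjoin \<theta> A" and "mono F"
  define L where "L d j = lead_coeffs \<theta> A d (F j)" for d j
  have sub: "submod \<Omega> (F j)" for j
    using F by (auto simp: submod_def)
  have L: "submod \<Omega> (L d j)" "L d j \<subseteq> A" for d j
    unfolding L_def using submod_lead_coeffs[OF A' ops add comm sub] lead_coeffs_subset by blast+
  have L1: "L d i \<subseteq> L d j" if "i \<le> j" for d i j
    unfolding L_def using lead_coeffs_mono[OF monoD[OF \<open>mono F\<close> that]] .
  have L2: "L d j \<subseteq> L e j" if "d \<le> e" for d e j
  proof -
    have "L d j \<subseteq> L (Suc d) j" for d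
      unfolding L_def
    proof (rule lead_coeffs_Suc[OF A' add])
      show "\<theta> x \<in> F j" if "x \<in> F j" for x
        using F that submod_op[of "insert \<theta> \<Omega>" "F j" \<theta> x] by blast
    qed
    then show ?thesis
      using lift_Suc_mono_le[of "\<lambda>d. L d j", OF _ that] by blast
  qed
  \<comment> \<open>\<open>L\<close> increases in both arguments, so its diagonal is a chain in A.
    This settles all degrees from k on; the finitely many degrees below k are stabilised one by
    one.\<close>
  obtain k where k: "\<And>i. i \<ge> k \<Longrightarrow> L i i = L k k"
  proof (rule noetherian_chain[OF A, of "\<lambda>i. L i i"])
    show "L i i \<subseteq> L (Suc i) (Suc i)" for i
      using L1[of i "Suc i" i] L2[of i "Suc i" "Suc i"] by simp
  qed (use L in auto)
  have "\<exists>c. \<forall>j\<ge>c. L d j = L d c" for d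
  proof (rule noetherian_chain[OF A, of "\<lambda>j. L d j"])
    show "L d i \<subseteq> L d (Suc i)" for i
      using L1 by simp
  qed (use L in auto)
  then obtain c where c: "\<And>d j. j \<ge> c d \<Longrightarrow> L d j = L d (c d)"
    by metis
  define K where "K = Max (insert k (c ` {..<k}))"
  have K: "k \<le> K" "\<And>d. d < k \<Longrightarrow> c d \<le> K"
    unfolding K_def by (auto intro: Max_ge)
  have stable: "L d j = L d K" if "j \<ge> K" for d j
  proof (cases "d < k")
    case True
    then show ?thesis
      using c[of d j] c[of d K] K(2)[OF True] that by simp
  next
    case False
    \<comment> \<open>For d and i at least k, \<open>L d i\<close> is squeezed between
      \<open>L k k\<close> and a later diagonal entry, which equals \<open>L k k\<close>.\<close>
    have "L d i = L k k" if "i \<ge> k" for i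
    proof
      have "L d i \<subseteq> L (max d i) (max d i)"
        using L1[of i "max d i" d] L2[of d "max d i" "max d i"] by simp
      then show "L d i \<subseteq> L k k"
        using k[of "max d i"] that by auto
      show "L k k \<subseteq> L d i"
        using False L1[OF that, of k] L2[of k d i] by simp
    qed
    then show ?thesis
      using that K(1) by auto
  qed
  have "F j = F K" if "j \<ge> K" for j
  proof (rule submod_eq_if_lead_coeffs_eq[OF A' add sub sub _ monoD[OF \<open>mono F\<close> that]])
    show "F j \<subseteq> adjoin \<theta> A"
      using F by blast
    show "lead_coeffs \<theta> A d (F j) = lead_coeffs \<theta> A d (F K)" for d
      using stable[OF that, of d] unfolding L_def .
  qed
  then show "\<exists>k. \<forall>i\<ge>k. F i = F k"
    by blast
qed

section \<open>Primary decomposition over the coefficient ring\<close>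

text \<open>Scalar multiplications belong to \<Omega>, so each \<open>submod\<close> is an
  R-submodule. Commutativity makes images and preimages under operators into submodules
  again.\<close>

locale operator_module = module scale
  for scale :: "'r::comm_ring_1 \<Rightarrow> 'c::ab_group_add \<Rightarrow> 'c" (infixr \<open>*s\<close> 75) +
  fixes \<Omega> :: "('c \<Rightarrow> 'c) set" and A :: "'c set"
  assumes op_additive: "f \<in> \<Omega> \<Longrightarrow> additive f"
    and op_commute: "f \<in> \<Omega> \<Longrightarrow> g \<in> \<Omega> \<Longrightarrow> f (g x) = g (f x)"
    and scale_op: "(*s) r \<in> \<Omega>"
    and noetherian_carrier: "noetherian \<Omega> A"
begin

lemma submod_carrier: "submod \<Omega> A"
  using noetherian_carrier by (rule noetherian_submod)

lemma op_scale: "f \<in> \<Omega> \<Longrightarrow> f (r *s x) = r *s f x"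
  using op_commute[OF _ scale_op] .

lemma op_zero: "f \<in> \<Omega> \<Longrightarrow> f 0 = 0"
  and op_add: "f \<in> \<Omega> \<Longrightarrow> f (x + y) = f x + f y"
  and op_diff: "f \<in> \<Omega> \<Longrightarrow> f (x - y) = f x - f y"
  using op_additive additive.zero additive.add additive.diff by blast+

lemma submod_scale: "submod \<Omega> N \<Longrightarrow> x \<in> N \<Longrightarrow> r *s x \<in> N"
  using submod_op[OF _ scale_op] .

lemma submod_subspace: "submod \<Omega> N \<Longrightarrow> subspace N"
  by (auto intro!: subspaceI simp: submod_zero submod_add submod_scale)

section \<open>Images, sums, preimages and ideal multiples of submodules\<close>

lemma submod_image:
  assumes f: "f \<in> \<Omega>" and N: "submod \<Omega> N"
  shows "submod \<Omega> (f ` N)"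
proof (rule submodI)
  show "0 \<in> f ` N"
    using submod_zero[OF N] op_zero[OF f] by (metis imageI)
  show "x - y \<in> f ` N" if "x \<in> f ` N" "y \<in> f ` N" for x y
    using that submod_diff[OF N] op_diff[OF f] by (auto simp flip: op_diff[OF f])
  show "g x \<in> f ` N" if "g \<in> \<Omega>" "x \<in> f ` N" for g x
    using that submod_op[OF N] op_commute[OF f] by (metis (no_types, lifting) image_iff)
qed

lemma submod_plus:
  assumes M: "submod \<Omega> M" and N: "submod \<Omega> N"
  shows "submod \<Omega> {x + y | x y. x \<in> M \<and> y \<in> N}" (is "submod \<Omega> ?S")
proof (rule submodI)
  show "0 \<in> ?S"
    using submod_zero[OF M] submod_zero[OF N] by force
next
  fix u v assume "u \<in> ?S" "v \<in> ?S"
  then obtain x y x' y' where *: "u = x + y" "v = x' + y'" "x \<in> M" "y \<in> N" "x' \<in> M" "y' \<in> N"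
    by blast
  then have "u - v = (x - x') + (y - y')"
    by simp
  then show "u - v \<in> ?S"
    using * submod_diff[OF M] submod_diff[OF N] by blast
next
  fix f u assume f: "f \<in> \<Omega>" and "u \<in> ?S"
  then obtain x y where *: "u = x + y" "x \<in> M" "y \<in> N"
    by blast
  then have "f u = f x + f y"
    by (simp add: op_add f)
  then show "f u \<in> ?S"
    using * f submod_op[OF M f] submod_op[OF N f] by blast
qed

lemma submod_vimage:
  assumes f: "f \<in> \<Omega>" and N: "submod \<Omega> N"
  shows "submod \<Omega> {x \<in> A. f x \<in> N}"
  by (rule submodI)
    (auto simp: op_zero[OF f] op_diff[OF f] op_commute[OF f] submod_zero[OF N] submod_diff[OF N]
       submod_op[OF N] submod_zero[OF submod_carrier] submod_diff[OF submod_carrier]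
       submod_op[OF submod_carrier])

lemma submod_ideal_smult:
  assumes N: "submod \<Omega> N"
  shows "submod \<Omega> (ideal_smult scale J N)"
proof (rule submodI)
  show "0 \<in> ideal_smult scale J N"
    by (simp add: ideal_smult_def span_zero)
  show "x - y \<in> ideal_smult scale J N"
    if "x \<in> ideal_smult scale J N" "y \<in> ideal_smult scale J N" for x y
    using that by (simp add: ideal_smult_def span_diff)
  fix f x assume f: "f \<in> \<Omega>" and "x \<in> ideal_smult scale J N"
  then have "x \<in> span {r *s x | r x. r \<in> J \<and> x \<in> N}"
    by (simp add: ideal_smult_def)
  then show "f x \<in> ideal_smult scale J N"
  proof (induction x rule: span_induct_alt)
    case base
    then show ?case
      by (simp add: ideal_smult_def span_zero op_zero[OF f])
  next
    case (step c x y)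
    then obtain r z where "x = r *s z" "r \<in> J" "z \<in> N"
      by blast
    then have "f x \<in> ideal_smult scale J N"
      unfolding ideal_smult_def using submod_op[OF N f] op_scale[OF f] by (auto intro!: span_base)
    then show ?case
      using step.IH
      by (simp add: ideal_smult_def op_add[OF f] op_scale[OF f] span_add span_scale)
  qed
qed

lemma ideal_smult_base: "r \<in> J \<Longrightarrow> x \<in> N \<Longrightarrow> r *s x \<in> ideal_smult scale J N"
  unfolding ideal_smult_def by (rule span_base) blast

lemma ideal_smult_least:
  assumes "submod \<Omega> W" "\<And>r x. r \<in> J \<Longrightarrow> x \<in> N \<Longrightarrow> r *s x \<in> W"
  shows "ideal_smult scale J N \<subseteq> W"
  unfolding ideal_smult_def
  by (rule span_minimal) (use assms submod_subspace in auto)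

abbreviation smult_pow :: "'r set \<Rightarrow> nat \<Rightarrow> 'c set \<Rightarrow> 'c set" where
  "smult_pow J a \<equiv> (ideal_smult scale J) ^^ a"

lemma submod_smult_pow: "submod \<Omega> N \<Longrightarrow> submod \<Omega> (smult_pow J a N)"
  by (induction a) (auto simp: submod_ideal_smult)

lemma ideal_smult_mono: "I \<subseteq> J \<Longrightarrow> M \<subseteq> N \<Longrightarrow> ideal_smult scale I M \<subseteq> ideal_smult scale J N"
  unfolding ideal_smult_def by (rule span_mono) blast

lemma smult_pow_mono: "I \<subseteq> J \<Longrightarrow> M \<subseteq> N \<Longrightarrow> smult_pow I a M \<subseteq> smult_pow J a N"
  by (induction a) (auto simp: ideal_smult_mono[THEN subsetD])

lemma smult_pow_antimono:
  assumes N: "submod \<Omega> N" and "a \<le> b"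
  shows "smult_pow J b N \<subseteq> smult_pow J a N"
proof -
  have "smult_pow J (Suc a) N \<subseteq> smult_pow J a N" for a
    using ideal_smult_least[OF submod_smult_pow[OF N]] submod_scale[OF submod_smult_pow[OF N]]
    by simp
  then show ?thesis
    using lift_Suc_antimono_le[of "\<lambda>a. smult_pow J a N", OF _ \<open>a \<le> b\<close>] by blast
qed

lemma smult_pow_subset: "submod \<Omega> N \<Longrightarrow> smult_pow J a N \<subseteq> N"
  using smult_pow_antimono[of N 0 a] by simp

lemma smult_pow_image:
  assumes f: "f \<in> \<Omega>" and N: "submod \<Omega> N"
  shows "smult_pow J a (f ` N) \<subseteq> f ` smult_pow J a N"
proof (induction a)
  case (Suc a)
  have "ideal_smult scale J (smult_pow J a (f ` N)) \<subseteq> f ` smult_pow J (Suc a) N"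
  proof (rule ideal_smult_least)
    show "submod \<Omega> (f ` smult_pow J (Suc a) N)"
      using submod_image[OF f submod_smult_pow[OF N]] .
    fix r x assume "r \<in> J" "x \<in> smult_pow J a (f ` N)"
    then obtain y where "y \<in> smult_pow J a N" "x = f y"
      using Suc.IH by blast
    then show "r *s x \<in> f ` smult_pow J (Suc a) N"
      using ideal_smult_base[OF \<open>r \<in> J\<close>] by (auto simp flip: op_scale[OF f])
  qed
  then show ?case
    by simp
qed simp

text \<open>The radical of the annihilator of A/Q: one exponent has to serve all of A.\<close>

definition radical :: "'c set \<Rightarrow> 'r set" where
  "radical Q = {r. \<exists>e. \<forall>z\<in>A. r ^ e *s z \<in> Q}"

text \<open>Only scalars from R are tested, not all operators. The improper submodule A is allowed;
  its radical is the unit ideal.\<close>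

definition primary :: "'c set \<Rightarrow> bool" where
  "primary Q \<longleftrightarrow> submod \<Omega> Q \<and> Q \<subseteq> A \<and> (\<forall>r z. r \<notin> radical Q \<longrightarrow> z \<in> A \<longrightarrow> r *s z \<in> Q \<longrightarrow> z \<in> Q)"

text \<open>Noether's argument: if r is a zero divisor on A/N but not nilpotent there, then N is the
  intersection of the strictly larger (N : r^e) and N + r^e A once the chain of colons is stationary
  at e.\<close>

lemma not_primary_decomp:
  assumes N: "submod \<Omega> N" "N \<subseteq> A" and "\<not> primary N"
  obtains M M' where "submod \<Omega> M" "M \<subseteq> A" "N \<subset> M" "submod \<Omega> M'" "M' \<subseteq> A" "N \<subset> M'" "N = M \<inter> M'"
proof -
  obtain r z where r: "r \<notin> radical N" and z: "z \<in> A" "r *s z \<in> N" "z \<notin> N"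
    using assms unfolding primary_def by blast
  define F where "F e = {w \<in> A. r ^ e *s w \<in> N}" for e
  obtain k where k: "\<And>i. i \<ge> k \<Longrightarrow> F i = F k"
  proof (rule noetherian_chain[OF noetherian_carrier, of F])
    show "submod \<Omega> (F i)" for i
      unfolding F_def using submod_vimage[OF scale_op N(1)] .
    show "F i \<subseteq> F (Suc i)" for i
      unfolding F_def using submod_scale[OF N(1), of "r ^ _ *s _" r] by auto
  qed (auto simp: F_def)
  \<comment> \<open>The successor makes r^e z = r^k (r z) lie in N at once, while e stays in the
    stationary range.\<close>
  define e where "e = Suc k"
  define M' where "M' = {x + y | x y. x \<in> N \<and> y \<in> (*s) (r ^ e) ` A}"
  have "F e \<inter> M' \<subseteq> N"
  proof
    fix u assume u: "u \<in> F e \<inter> M'"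
    then obtain x w where *: "u = x + r ^ e *s w" "x \<in> N" "w \<in> A"
      unfolding M'_def by blast
    have "r ^ e *s u \<in> N"
      using u unfolding F_def by blast
    then have "r ^ e *s u - r ^ e *s x \<in> N"
      using submod_diff[OF N(1)] submod_scale[OF N(1) *(2)] by blast
    \<comment> \<open>Stationarity lowers the exponent from 2e to e, which puts r^e w, and so u,
      into N.\<close>
    then have "r ^ (e + e) *s w \<in> N"
      by (simp add: * scale_right_distrib power_add)
    then have "w \<in> F (e + e)"
      using * by (simp add: F_def)
    then have "w \<in> F e"
      using k[of e] k[of "e + e"] by (simp add: e_def)
    then show "u \<in> N"
      using * submod_add[OF N(1)] by (simp add: F_def)
  qed
  moreover have "N \<subseteq> F e"
    unfolding F_def using N submod_scale[OF N(1)] by blast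
  moreover have "N \<subseteq> M'"
    unfolding M'_def using submod_zero[OF submod_carrier] by force
  moreover have "z \<in> F e"
    unfolding F_def e_def power_Suc2 using z submod_scale[OF N(1) z(2), of "r ^ k"] by simp
  moreover have "\<exists>w\<in>A. r ^ e *s w \<notin> N"
    using r unfolding radical_def by blast
  then have "\<exists>w\<in>M'. w \<notin> N"
    unfolding M'_def using submod_zero[OF N(1)] by force
  moreover have "submod \<Omega> (F e)" "F e \<subseteq> A"
    unfolding F_def using submod_vimage[OF scale_op N(1)] by auto
  moreover have "submod \<Omega> M'"
    unfolding M'_def using submod_plus[OF N(1) submod_image[OF scale_op submod_carrier]] .
  moreover have "M' \<subseteq> A"
    unfolding M'_def using N(2) submod_add[OF submod_carrier] submod_scale[OF submod_carrier] by blast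
  ultimately show thesis
    using z(3) that[of "F e" M'] by blast
qed

theorem primary_decomposition:
  assumes "submod \<Omega> N" "N \<subseteq> A"
  shows "\<exists>\<Q>. finite \<Q> \<and> (\<forall>Q\<in>\<Q>. primary Q) \<and> N = A \<inter> \<Inter>\<Q>"
  using noetherian_carrier assms
proof (induction N rule: noetherian_induct)
  case (step N)
  show ?case
  proof (cases "primary N")
    case True
    then show ?thesis
      using step by (intro exI[of _ "{N}"]) auto
  next
    case False
    obtain M M' where *: "submod \<Omega> M" "M \<subseteq> A" "N \<subset> M" "submod \<Omega> M'" "M' \<subseteq> A" "N \<subset> M'" "N = M \<inter> M'"
      using not_primary_decomp[OF step(1,2) False] .
    obtain \<Q> where Q: "finite \<Q>" "\<forall>Q\<in>\<Q>. primary Q" "M = A \<inter> \<Inter>\<Q>"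
      using step.IH[OF *(1-3)] by blast
    obtain \<Q>' where Q': "finite \<Q>'" "\<forall>Q\<in>\<Q>'. primary Q" "M' = A \<inter> \<Inter>\<Q>'"
      using step.IH[OF *(4-6)] by blast
    have "N = A \<inter> \<Inter>(\<Q> \<union> \<Q>')"
      using *(7) Q(3) Q'(3) by blast
    then show ?thesis
      using Q Q' by (intro exI[of _ "\<Q> \<union> \<Q>'"]) auto
  qed
qed

text \<open>The elements of S are treated in turn: y is replaced by the last s^j y outside W. The
  earlier elements still send it into W, because W is closed under scalars.\<close>

lemma common_killed_element:
  assumes W: "submod \<Omega> W" and "finite S"
    and nil: "\<And>s. s \<in> S \<Longrightarrow> \<exists>e. \<forall>z\<in>A. s ^ e *s z \<in> W"
    and "z \<in> A" "z \<notin> W"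
  shows "\<exists>z'\<in>A. z' \<notin> W \<and> (\<forall>s\<in>S. s *s z' \<in> W)"
  using \<open>finite S\<close> nil
proof (induction S rule: finite_induct)
  case empty
  then show ?case
    using assms by blast
next
  case (insert s S)
  then obtain y where y: "y \<in> A" "y \<notin> W" "\<forall>s\<in>S. s *s y \<in> W"
    by blast
  obtain e where "s ^ e *s y \<in> W"
    using insert.prems y(1) by blast
  define k where "k = (LEAST e. s ^ e *s y \<in> W)"
  have k: "s ^ k *s y \<in> W" "\<And>j. j < k \<Longrightarrow> s ^ j *s y \<notin> W"
    unfolding k_def using LeastI[of "\<lambda>e. s ^ e *s y \<in> W"] not_less_Least \<open>s ^ e *s y \<in> W\<close> by blast+
  have "k \<noteq> 0"
    using k(1) y(2) by (metis power_0 scale_one)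
  then obtain j where j: "k = Suc j"
    by (cases k) auto
  have "s' *s (s ^ j *s y) \<in> W" if "s' \<in> S" for s'
    using y(3) that submod_scale[OF W, of "s' *s y" "s ^ j"] by (simp add: mult.commute)
  moreover have "s *s (s ^ j *s y) \<in> W"
    using k(1) j by simp
  ultimately show ?case
    using submod_scale[OF submod_carrier y(1)] k(2)[of j] j by auto
qed

text \<open>For sums, no binomial expansion is made: some y outside Q is sent into Q by a and by b,
  hence by a + b, and primariness then forces a + b into the radical.\<close>

lemma radical_ideal:
  assumes Q: "primary Q"
  shows "is_ideal (radical Q)"
proof -
  have sub: "submod \<Omega> Q"
    using Q by (simp add: primary_def)
  have "0 \<in> radical Q"
    unfolding radical_def using submod_zero[OF sub] by (auto intro!: exI[of _ 1])
  moreover have "r * a \<in> radical Q" if a: "a \<in> radical Q" for r a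
  proof -
    obtain e where e: "\<forall>z\<in>A. a ^ e *s z \<in> Q"
      using a unfolding radical_def by blast
    have "(r * a) ^ e *s z \<in> Q" if "z \<in> A" for z
      using submod_scale[OF sub e[rule_format, OF that], of "r ^ e"] by (simp add: power_mult_distrib)
    then show ?thesis
      unfolding radical_def by blast
  qed
  moreover have "a + b \<in> radical Q" if ab: "a \<in> radical Q" "b \<in> radical Q" for a b
  proof (rule ccontr)
    assume *: "a + b \<notin> radical Q"
    then obtain z where z: "z \<in> A" "z \<notin> Q"
      unfolding radical_def using submod_scale[OF sub] by blast
    obtain y where y: "y \<in> A" "y \<notin> Q" "a *s y \<in> Q" "b *s y \<in> Q"
      using common_killed_element[OF sub _ _ z, of "{a, b}"] ab unfolding radical_def by auto
    then have "(a + b) *s y \<in> Q"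
      using submod_add[OF sub] by (simp add: scale_left_distrib)
    then show False
      using Q * y unfolding primary_def by blast
  qed
  ultimately show ?thesis
    unfolding is_ideal_def by blast
qed

end

section \<open>Torsion with respect to an ideal\<close>

lemma ideal_gen_least: "is_ideal I \<Longrightarrow> S \<subseteq> I \<Longrightarrow> ideal_gen S \<subseteq> I"
  unfolding ideal_gen_def by blast

lemma is_ideal_Inter: "(\<And>I. I \<in> \<I> \<Longrightarrow> is_ideal I) \<Longrightarrow> is_ideal (\<Inter>\<I>)"
  unfolding is_ideal_def by blast

lemma subset_ideal_gen: "S \<subseteq> ideal_gen S"
  unfolding ideal_gen_def by blast

context operator_module
begin

lemma ideal_of_submod:
  assumes "submod \<Omega> W"
  shows "is_ideal {r. \<forall>x\<in>N. r *s x \<in> W}"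
  using submod_zero[OF assms] submod_add[OF assms] submod_scale[OF assms]
  unfolding is_ideal_def by (auto simp: scale_left_distrib simp flip: scale_scale)

lemma ideal_gen_scale_subset:
  assumes "submod \<Omega> W" "\<And>s x. s \<in> S \<Longrightarrow> x \<in> N \<Longrightarrow> s *s x \<in> W" "r \<in> ideal_gen S" "x \<in> N"
  shows "r *s x \<in> W"
  using ideal_gen_least[OF ideal_of_submod[OF assms(1)], of S N] assms by blast

text \<open>The colon (Q : J^e) in A, for Q inside A, obtained by e successive colons by J.\<close>

primrec colon :: "'r set \<Rightarrow> 'c set \<Rightarrow> nat \<Rightarrow> 'c set" where
  "colon J Q 0 = Q"
| "colon J Q (Suc e) = {z \<in> A. \<forall>r\<in>J. r *s z \<in> colon J Q e}"

text \<open>An unbounded form of \<open>(N : J\<^sup>\<infinity>)\<close>; the number of steps needed is not recorded.\<close>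

inductive_set torsion :: "'r set \<Rightarrow> 'c set \<Rightarrow> 'c set" for J N where
  base: "z \<in> N \<Longrightarrow> z \<in> torsion J N"
| step: "(\<And>r. r \<in> J \<Longrightarrow> r *s z \<in> torsion J N) \<Longrightarrow> z \<in> torsion J N"

lemma colon_subset_torsion: "colon J Q e \<subseteq> torsion J Q"
  by (induction e) (auto intro: torsion.intros)

lemma
  assumes Q: "submod \<Omega> Q" "Q \<subseteq> A"
  shows submod_colon: "submod \<Omega> (colon J Q e)"
    and colon_subset: "colon J Q e \<subseteq> A"
    and colon_Suc: "colon J Q e \<subseteq> colon J Q (Suc e)"
proof -
  show *: "submod \<Omega> (colon J Q e)" for e
  proof (induction e)
    case (Suc e)
    show ?case
      by (rule submodI)
        (auto simp: submod_zero[OF Suc] submod_diff[OF Suc] submod_op[OF Suc] scale_right_diff_distrib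
          submod_zero[OF submod_carrier] submod_diff[OF submod_carrier]
          submod_op[OF submod_carrier] simp flip: op_scale)
  qed (use Q in auto)
  show **: "colon J Q e \<subseteq> A"
    using Q by (cases e) auto
  show "colon J Q e \<subseteq> colon J Q (Suc e)"
    using ** submod_scale[OF *] by auto
qed

lemma smult_pow_colon:
  assumes Q: "submod \<Omega> Q" "Q \<subseteq> A"
  shows "smult_pow J e (colon J Q e) \<subseteq> Q"
proof (induction e)
  case (Suc e)
  have "ideal_smult scale J (colon J Q (Suc e)) \<subseteq> colon J Q e"
    using submod_colon[OF Q] by (intro ideal_smult_least) auto
  then have "smult_pow J e (ideal_smult scale J (colon J Q (Suc e))) \<subseteq> smult_pow J e (colon J Q e)"
    by (intro smult_pow_mono) auto
  then show ?case
    using Suc.IH by (auto simp only: funpow_Suc_right comp_apply)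
qed simp

text \<open>Let W be the stationary value of (Q : J^e). If W were smaller than A, an element outside
  W sent into W by the finitely many generators of J would lie in the next colon.\<close>

lemma fg_ideal_in_radical:
  assumes Q: "submod \<Omega> Q" "Q \<subseteq> A" and "finite S" and J: "J = ideal_gen S" "J \<subseteq> radical Q"
  shows "\<exists>e. smult_pow J e A \<subseteq> Q \<and> A \<subseteq> torsion J Q"
proof -
  obtain k where k: "\<And>i. i \<ge> k \<Longrightarrow> colon J Q i = colon J Q k"
    by (rule noetherian_chain[OF noetherian_carrier, of "colon J Q"])
      (use submod_colon[OF Q] colon_subset[OF Q] colon_Suc[OF Q] in blast)+
  let ?W = "colon J Q k"
  have W: "submod \<Omega> ?W"
    using submod_colon[OF Q] .
  have "Q \<subseteq> ?W"
    using lift_Suc_mono_le[of "colon J Q" 0 k] colon_Suc[OF Q] by simp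
  have "A \<subseteq> ?W"
  proof (rule ccontr)
    assume "\<not> A \<subseteq> ?W"
    then obtain z where z: "z \<in> A" "z \<notin> ?W"
      by blast
    have "\<exists>e. \<forall>z\<in>A. s ^ e *s z \<in> ?W" if "s \<in> S" for s
      using that J subset_ideal_gen[of S] \<open>Q \<subseteq> ?W\<close> unfolding radical_def by blast
    then obtain y where y: "y \<in> A" "y \<notin> ?W" "\<forall>s\<in>S. s *s y \<in> ?W"
      using common_killed_element[OF W \<open>finite S\<close> _ z] by blast
    have "r *s y \<in> ?W" if "r \<in> J" for r
      using ideal_gen_scale_subset[OF W, of S "{y}"] y(3) that J(1) by blast
    then have "y \<in> colon J Q (Suc k)"
      using y(1) by simp
    then show False
      using k[OF le_SucI[OF order_refl]] y(2) by blast
  qed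
  then have "A = ?W"
    using colon_subset[OF Q] by blast
  then show ?thesis
    using smult_pow_colon[OF Q, of k J] colon_subset_torsion[of J Q k] by auto
qed

lemma torsion_op:
  assumes "z \<in> torsion J N" "submod \<Omega> N" "f \<in> \<Omega>"
  shows "f z \<in> torsion J N"
  using assms
  by (induction rule: torsion.induct) (auto intro: torsion.intros submod_op simp flip: op_scale)

text \<open>With no exponents to compare, two inductions are nested: the outer one descends into M,
  and from there the inner one descends into N without leaving M.\<close>

lemma torsion_Int:
  assumes M: "submod \<Omega> M" and N: "submod \<Omega> N" and z: "z \<in> torsion J M" "z \<in> torsion J N"
  shows "z \<in> torsion J (M \<inter> N)"
proof -
  have *: "z \<in> torsion J (M \<inter> N)" if "z \<in> torsion J N" "z \<in> M" for z
    using that by (induction rule: torsion.induct) (auto intro: torsion.intros submod_scale[OF M])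
  show ?thesis
    using z
    by (induction rule: torsion.induct)
      (auto intro: * torsion.step torsion_op[OF _ N scale_op])
qed

text \<open>A scalar r outside the radical can be cancelled modulo Q, so each torsion step is undone
  by using this single r.\<close>

lemma torsion_primary:
  assumes Q: "primary Q" and "r \<in> J" "r \<notin> radical Q" and "N \<subseteq> Q" and z: "z \<in> torsion J N" "z \<in> A"
  shows "z \<in> Q"
  using z
proof (induction rule: torsion.induct)
  case (step z)
  then have "r *s z \<in> Q"
    using \<open>r \<in> J\<close> submod_scale[OF submod_carrier] by blast
  then show ?case
    using Q \<open>r \<notin> radical Q\<close> \<open>z \<in> A\<close> unfolding primary_def by blast
qed (use \<open>N \<subseteq> Q\<close> in blast)

end

section \<open>The Artin--Rees lemma\<close>

context operator_module
begin

text \<open>C contains the homogeneous elements of the Rees module, the direct sum of the J^a A,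
  realised as functions of the degree. It arises from a copy of A in degree 0 by adjoining, for each
  generator s of J, the operator that multiplies by s and raises the degree by one.\<close>

lemma noetherian_rees:
  assumes "finite S"
  obtains C where "\<And>a z. z \<in> smult_pow (ideal_gen S) a A \<Longrightarrow> (\<lambda>b. if b = a then z else 0) \<in> C"
    and "noetherian ((\<lambda>f g a. f (g a)) ` \<Omega> \<union> (\<lambda>s g a. case a of 0 \<Rightarrow> 0 | Suc a \<Rightarrow> s *s g a) ` S) C"
proof -
  define lift :: "('c \<Rightarrow> 'c) \<Rightarrow> (nat \<Rightarrow> 'c) \<Rightarrow> (nat \<Rightarrow> 'c)" where "lift f g = (\<lambda>a. f (g a))" for f g
  define \<theta> :: "'r \<Rightarrow> (nat \<Rightarrow> 'c) \<Rightarrow> (nat \<Rightarrow> 'c)"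
    where "\<theta> s g = (\<lambda>a. case a of 0 \<Rightarrow> 0 | Suc a \<Rightarrow> s *s g a)" for s g
  define C\<^sub>0 where "C\<^sub>0 = {\<lambda>a::nat. if a = 0 then z else 0 | z. z \<in> A}"
  have lift_add: "additive (lift f)" if "f \<in> \<Omega>" for f
    using that by (auto simp: additive_def lift_def op_add)
  have \<theta>_add: "additive (\<theta> s)" for s
    by (auto simp: additive_def \<theta>_def scale_right_distrib split: nat.split)
  have C0: "noetherian (lift ` \<Omega>) C\<^sub>0"
    unfolding noetherian_def
  proof (intro conjI allI impI)
    show "submod (lift ` \<Omega>) C\<^sub>0"
    proof (rule submodI)
      show "0 \<in> C\<^sub>0"
        unfolding C\<^sub>0_def using submod_zero[OF submod_carrier] by force
    next
      fix x y assume "x \<in> C\<^sub>0" "y \<in> C\<^sub>0"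
      then obtain u v where *: "x = (\<lambda>a. if a = 0 then u else 0)" "y = (\<lambda>a. if a = 0 then v else 0)"
        "u \<in> A" "v \<in> A"
        unfolding C\<^sub>0_def by blast
      then have "x - y = (\<lambda>a. if a = 0 then u - v else 0)"
        by auto
      then show "x - y \<in> C\<^sub>0"
        unfolding C\<^sub>0_def using * submod_diff[OF submod_carrier] by blast
    next
      fix f x assume "f \<in> lift ` \<Omega>" "x \<in> C\<^sub>0"
      then obtain h u where *: "f = lift h" "h \<in> \<Omega>" "x = (\<lambda>a. if a = 0 then u else 0)" "u \<in> A"
        unfolding C\<^sub>0_def by blast
      then have "f x = (\<lambda>a. if a = 0 then h u else 0)"
        by (auto simp: lift_def op_zero)
      then show "f x \<in> C\<^sub>0"
        unfolding C\<^sub>0_def using * submod_op[OF submod_carrier] by blast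
    qed
  next
    fix F :: "nat \<Rightarrow> (nat \<Rightarrow> 'c) set"
    assume F: "\<forall>i. submod (lift ` \<Omega>) (F i) \<and> F i \<subseteq> C\<^sub>0" and "mono F"
    \<comment> \<open>Evaluation at degree 0 is injective on the degree-0 copy of A, so the chain
      condition is inherited from A.\<close>
    define G where "G i = (\<lambda>g. g 0) ` F i" for i
    obtain k where k: "\<And>i. i \<ge> k \<Longrightarrow> G i = G k"
    proof (rule noetherian_chain[OF noetherian_carrier, of G])
      show "submod \<Omega> (G i)" for i
      proof (rule submodI)
        have sub: "submod (lift ` \<Omega>) (F i)"
          using F by blast
        show "0 \<in> G i"
          unfolding G_def using imageI[OF submod_zero[OF sub], of "\<lambda>g. g 0"] by simp
        show "x - y \<in> G i" if "x \<in> G i" "y \<in> G i" for x y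
          using that imageI[OF submod_diff[OF sub], of _ _ "\<lambda>g. g 0"] unfolding G_def by auto
        show "f x \<in> G i" if "f \<in> \<Omega>" "x \<in> G i" for f x
          using that imageI[OF submod_op[OF sub, of "lift f"], of _ "\<lambda>g. g 0"]
          unfolding G_def lift_def by auto
      qed
      show "G i \<subseteq> A" for i
        unfolding G_def using F unfolding C\<^sub>0_def by force
      show "G i \<subseteq> G (Suc i)" for i
        unfolding G_def using monoD[OF \<open>mono F\<close>, of i "Suc i"] by auto
    qed blast
    have "F i = (\<lambda>u a. if a = 0 then u else 0) ` G i" for i
    proof -
      have "(\<lambda>a. if a = 0 then g 0 else 0) = g" if "g \<in> F i" for g
        using F that unfolding C\<^sub>0_def by force
      then show ?thesis
        unfolding G_def image_image by simp
    qed
    then show "\<exists>k. \<forall>i\<ge>k. F i = F k"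
      using k by metis
  qed
  have "\<exists>C. C\<^sub>0 \<subseteq> C \<and> noetherian (lift ` \<Omega> \<union> \<theta> ` S) C"
    using \<open>finite S\<close>
  proof (induction S rule: finite_induct)
    case empty
    then show ?case
      using C0 by auto
  next
    case (insert s S)
    then obtain C where C: "C\<^sub>0 \<subseteq> C" "noetherian (lift ` \<Omega> \<union> \<theta> ` S) C"
      by blast
    have "noetherian (insert (\<theta> s) (lift ` \<Omega> \<union> \<theta> ` S)) (adjoin (\<theta> s) C)"
    proof (rule noetherian_adjoin[OF C(2) _ \<theta>_add])
      show "additive f" if "f \<in> lift ` \<Omega> \<union> \<theta> ` S" for f
        using that lift_add \<theta>_add by blast
      show "f (\<theta> s x) = \<theta> s (f x)" if "f \<in> lift ` \<Omega> \<union> \<theta> ` S" for f x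
        using that
        by (auto simp: lift_def \<theta>_def op_scale op_zero mult.commute split: nat.split)
    qed
    then show ?case
      using C(1) subset_adjoin[of C "\<theta> s"] by (intro exI[of _ "adjoin (\<theta> s) C"]) auto
  qed
  then obtain C where C: "C\<^sub>0 \<subseteq> C" "noetherian (lift ` \<Omega> \<union> \<theta> ` S) C"
    by blast
  have sub: "submod (lift ` \<Omega> \<union> \<theta> ` S) C"
    using noetherian_submod[OF C(2)] .
  define at where "at a z = (\<lambda>b::nat. if b = a then z else 0)" for a and z :: 'c
  have at: "at a z \<in> C" if "z \<in> smult_pow (ideal_gen S) a A" for a z
    using that
  proof (induction a arbitrary: z)
    case 0
    then show ?case
      using C(1) unfolding C\<^sub>0_def at_def by auto
  next
    case (Suc a)
    \<comment> \<open>Once this set is a submodule, it is enough to treat products s x with s a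
      generator of J, and these come from degree a through \<open>\<theta> s\<close>.\<close>
    have W: "submod \<Omega> {z. at (Suc a) z \<in> C}"
    proof (rule submodI)
      have "at (Suc a) 0 = 0"
        by (auto simp: at_def)
      then show "0 \<in> {z. at (Suc a) z \<in> C}"
        using submod_zero[OF sub] by simp
      show "x - y \<in> {z. at (Suc a) z \<in> C}"
        if "x \<in> {z. at (Suc a) z \<in> C}" "y \<in> {z. at (Suc a) z \<in> C}" for x y
      proof -
        have "at (Suc a) (x - y) = at (Suc a) x - at (Suc a) y"
          by (auto simp: at_def)
        then show ?thesis
          using submod_diff[OF sub] that by simp
      qed
      show "f x \<in> {z. at (Suc a) z \<in> C}" if "f \<in> \<Omega>" "x \<in> {z. at (Suc a) z \<in> C}" for f x
      proof -
        have "at (Suc a) (f x) = lift f (at (Suc a) x)"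
          using that by (auto simp: at_def lift_def op_zero)
        then show ?thesis
          using submod_op[OF sub, of "lift f"] that by simp
      qed
    qed
    have "r *s y \<in> {z. at (Suc a) z \<in> C}" if "r \<in> ideal_gen S" "y \<in> smult_pow (ideal_gen S) a A" for r y
    proof (rule ideal_gen_scale_subset[OF W _ that])
      fix s x assume "s \<in> S" and x: "x \<in> smult_pow (ideal_gen S) a A"
      have "at (Suc a) (s *s x) = \<theta> s (at a x)"
        by (auto simp: at_def \<theta>_def split: nat.split)
      then show "s *s x \<in> {z. at (Suc a) z \<in> C}"
        using submod_op[OF sub, of "\<theta> s"] Suc.IH[OF x] \<open>s \<in> S\<close> by simp
    qed
    then have "ideal_smult scale (ideal_gen S) (smult_pow (ideal_gen S) a A) \<subseteq> {z. at (Suc a) z \<in> C}"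
      by (rule ideal_smult_least[OF W])
    then show ?case
      using Suc.prems by auto
  qed
  show thesis
    using that[of C] at C(2) unfolding at_def lift_def[abs_def] \<theta>_def[abs_def] by blast
qed

text \<open>No generators of the sum of the J^a A \<inter> N are chosen; the constant is the index
  at which an ascending chain in the Noetherian Rees module becomes stationary.\<close>

theorem artin_rees:
  assumes "finite S" and J: "J = ideal_gen S" and N: "submod \<Omega> N"
  shows "\<exists>c. \<forall>a\<ge>c. smult_pow J a A \<inter> N \<subseteq> smult_pow J (a - c) N"
proof -
  let ?\<Omega> = "(\<lambda>f g a. f (g a)) ` \<Omega> \<union> (\<lambda>s g a. case a of 0 \<Rightarrow> 0 | Suc a \<Rightarrow> s *s g a) ` S"
  obtain C where C: "\<And>a z. z \<in> smult_pow J a A \<Longrightarrow> (\<lambda>b. if b = a then z else 0) \<in> C"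
    "noetherian ?\<Omega> C"
    using noetherian_rees[OF \<open>finite S\<close>] J by metis
  \<comment> \<open>The chain below grows with \<open>c\<close> because the truncated difference \<open>a - c\<close> decreases; in degree \<open>a\<close>
    it reaches \<open>J\<^sup>a A \<inter> N\<close> as soon as \<open>c \<ge> a\<close>.\<close>
  define D where "D c a = smult_pow J a A \<inter> smult_pow J (a - c) N" for c a
  have D: "submod \<Omega> (D c a)" for c a
    unfolding D_def using submod_Int submod_smult_pow submod_carrier N by blast
  have D_Suc: "s *s z \<in> D c (Suc a)" if "s \<in> S" "z \<in> D c a" for c a s z
  proof -
    have "s \<in> J"
      using that J subset_ideal_gen by blast
    then have "s *s z \<in> smult_pow J (Suc a) A" "s *s z \<in> smult_pow J (Suc (a - c)) N"
      using that ideal_smult_base unfolding D_def by auto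
    \<comment> \<open>Subtraction is truncated, so for a < c this is 0 against 1; the inequality
      suffices because powers of J decrease.\<close>
    moreover have "Suc a - c \<le> Suc (a - c)"
      by simp
    ultimately show ?thesis
      unfolding D_def using smult_pow_antimono[OF N] by blast
  qed
  define F where "F c = {g \<in> C. \<forall>a. g a \<in> D c a}" for c
  have sub: "submod ?\<Omega> C"
    using noetherian_submod[OF C(2)] .
  obtain c where c: "\<And>i. i \<ge> c \<Longrightarrow> F i = F c"
  proof (rule noetherian_chain[OF C(2), of F])
    show "submod ?\<Omega> (F c)" for c
    proof (rule submodI)
      show "0 \<in> F c"
        unfolding F_def using submod_zero[OF sub] submod_zero[OF D] by simp
      show "x - y \<in> F c" if "x \<in> F c" "y \<in> F c" for x y
        using that unfolding F_def by (simp add: submod_diff[OF sub] submod_diff[OF D])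
      show "f x \<in> F c" if f: "f \<in> ?\<Omega>" and x: "x \<in> F c" for f x
      proof -
        have "f x a \<in> D c a" for a
          using f x submod_op[OF D] submod_zero[OF D] D_Suc unfolding F_def
          by (auto split: nat.split)
        then show ?thesis
          using submod_op[OF sub f, of x] x unfolding F_def by blast
      qed
    qed
    show "F c \<subseteq> C" for c
      unfolding F_def by blast
    show "F c \<subseteq> F (Suc c)" for c
    proof -
      have "smult_pow J (a - c) N \<subseteq> smult_pow J (a - Suc c) N" for a
        using smult_pow_antimono[OF N] by simp
      then show ?thesis
        unfolding F_def D_def by blast
    qed
  qed blast
  have "z \<in> smult_pow J (a - c) N" if "a \<ge> c" "z \<in> smult_pow J a A" "z \<in> N" for a z
  proof -
    have "(\<lambda>b. if b = a then z else 0) \<in> F a"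
      unfolding F_def using C(1)[OF that(2)] submod_zero[OF D] that by (auto simp: D_def)
    then have "(\<lambda>b. if b = a then z else 0) \<in> F c"
      using c[OF that(1)] by simp
    then have "(if a = a then z else 0) \<in> D c a"
      unfolding F_def by blast
    then show ?thesis
      unfolding D_def by simp
  qed
  then show ?thesis
    by blast
qed

end

section \<open>Filtrations by images of injective operators\<close>

context operator_module
begin

lemma torsion_image:
  assumes f: "f \<in> \<Omega>" and "w \<in> torsion J N"
  shows "f w \<in> torsion J (f ` N)"
  using assms(2) by (induction rule: torsion.induct) (auto intro: torsion.intros simp flip: op_scale[OF f])

lemma torsion_image_cancel:
  assumes f: "f \<in> \<Omega>" "inj f" and "f w \<in> torsion J (f ` N)"
  shows "w \<in> torsion J N"
proof -
  have "\<forall>w. z = f w \<longrightarrow> w \<in> torsion J N" if "z \<in> torsion J (f ` N)" for z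
    using that
  proof (induction rule: torsion.induct)
    case (base z)
    then show ?case
      using \<open>inj f\<close> by (auto dest: injD intro: torsion.base)
  next
    case (step z)
    then show ?case
      by (metis op_scale[OF f(1)] torsion.step)
  qed
  then show ?thesis
    using assms(3) by blast
qed

lemma torsion_Inter:
  assumes "finite \<Q>" "\<And>Q. Q \<in> \<Q> \<Longrightarrow> submod \<Omega> Q" "\<And>Q. Q \<in> \<Q> \<Longrightarrow> z \<in> torsion J Q" "z \<in> A"
  shows "z \<in> torsion J (A \<inter> \<Inter>\<Q>)"
  using assms
proof (induction \<Q> rule: finite_induct)
  case empty
  then show ?case
    by (auto intro: torsion.base)
next
  case (insert Q \<Q>)
  have "z \<in> torsion J (Q \<inter> (A \<inter> \<Inter>\<Q>))"
  proof (rule torsion_Int)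
    show "submod \<Omega> (A \<inter> \<Inter>\<Q>)"
      using insert.prems(1) by (intro submod_Int submod_carrier submod_Inter) blast
    show "z \<in> torsion J (A \<inter> \<Inter>\<Q>)"
      by (rule insert.IH) (use insert.prems in blast)+
  qed (use insert.prems in blast)+
  moreover have "Q \<inter> (A \<inter> \<Inter>\<Q>) = A \<inter> \<Inter>(insert Q \<Q>)"
    by blast
  ultimately show ?case
    by simp
qed

end

text \<open>\<open>x i\<close> stands for T_i^-1, and \<open>\<Q> i\<close> is a chosen primary
  decomposition of x_i A.\<close>

locale multi_filtered_module = operator_module scale \<Omega> A
  for scale :: "'r::comm_ring_1 \<Rightarrow> 'c::ab_group_add \<Rightarrow> 'c" (infixr \<open>*s\<close> 75) and \<Omega> A +
  fixes x :: "'i::finite \<Rightarrow> 'c \<Rightarrow> 'c" and \<Q> :: "'i \<Rightarrow> 'c set set"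
  assumes noetherian_ring: "noetherian_ring TYPE('r)"
    and x_op: "x i \<in> \<Omega>" and x_inj: "inj (x i)"
    and \<Q>_finite: "finite (\<Q> i)" and \<Q>_primary: "Q \<in> \<Q> i \<Longrightarrow> primary Q"
    and \<Q>_Inter: "x i ` A = A \<inter> \<Inter>(\<Q> i)"
begin

text \<open>The submodule x^n A, with the monomial spelled as a word so that factors can be removed
  one at a time.\<close>

primrec ximage :: "'i list \<Rightarrow> 'c set" where
  "ximage [] = A"
| "ximage (i # is) = x i ` ximage is"

lemma submod_ximage: "submod \<Omega> (ximage is)"
  by (induction "is") (auto simp: submod_carrier submod_image x_op)

lemma ximage_subset: "ximage is \<subseteq> A"
proof (induction "is")
  case (Cons i "is")
  then show ?case
    using submod_op[OF submod_carrier x_op] by auto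
qed simp

lemma ximage_Cons_subset: "ximage (i # is) \<subseteq> x i ` A"
  using ximage_subset by auto

lemma x_image_subset: "Q \<in> \<Q> i \<Longrightarrow> x i ` A \<subseteq> Q"
  using \<Q>_Inter by blast

text \<open>A finite set that will contain all associated primes; a component equal to A contributes
  the unit ideal.\<close>

definition primes :: "'r set set" where
  "primes = radical ` (\<Union>i. \<Q> i)"

lemma finite_primes: "finite primes"
  unfolding primes_def using \<Q>_finite by simp

lemma ideal_fg: "is_ideal (J :: 'r set) \<Longrightarrow> \<exists>S. finite S \<and> J = ideal_gen S"
  using noetherian_ring unfolding noetherian_ring_def by blast

text \<open>If some s outside P gives s z = x_i w, then injectivity of x_i makes P the annihilator
  of w modulo the shorter product. Otherwise a component Q of x_i A has (Q : z) inside P, and then P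
  is the radical of Q.\<close>

theorem associated_prime_in_primes:
  assumes P: "prime_ideal P" and "z \<in> A" "P = {r. r *s z \<in> ximage is}"
  shows "P \<in> primes"
  using assms(2,3)
proof (induction "is" arbitrary: z)
  case Nil
  then have "P = UNIV"
    using submod_scale[OF submod_carrier] by auto
  then show ?case
    using P unfolding prime_ideal_def by blast
next
  case (Cons i "is")
  have prime: "\<And>a b. a * b \<in> P \<Longrightarrow> a \<in> P \<or> b \<in> P" and ideal: "\<And>r a. a \<in> P \<Longrightarrow> r * a \<in> P"
    and proper: "1 \<notin> P"
    using P unfolding prime_ideal_def is_ideal_def by (blast, blast, metis UNIV_eq_I mult.right_neutral)
  show ?case
  proof (cases "\<exists>s. s \<notin> P \<and> s *s z \<in> x i ` A")
    case True
    then obtain s w where s: "s \<notin> P" "s *s z = x i w" "w \<in> A"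
      by blast
    have "r \<in> P \<longleftrightarrow> r *s w \<in> ximage is" for r
    proof -
      have "r \<in> P \<longleftrightarrow> r * s \<in> P"
        using prime[of r s] ideal[of r s] s(1) by (auto simp: mult.commute)
      also have "\<dots> \<longleftrightarrow> r *s (s *s z) \<in> ximage (i # is)"
        using Cons.prems(2) by simp
      also have "\<dots> \<longleftrightarrow> x i (r *s w) \<in> x i ` ximage is"
        unfolding s(2) by (simp add: op_scale[OF x_op])
      also have "\<dots> \<longleftrightarrow> r *s w \<in> ximage is"
        using x_inj by (rule inj_image_mem_iff)
      finally show ?thesis .
    qed
    then show ?thesis
      using Cons.IH[OF s(3)] by blast
  next
    case False
    have "\<exists>Q\<in>\<Q> i. \<forall>s. s *s z \<in> Q \<longrightarrow> s \<in> P"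
    proof (rule ccontr)
      assume "\<not> ?thesis"
      then obtain s where s: "\<And>Q. Q \<in> \<Q> i \<Longrightarrow> s Q *s z \<in> Q \<and> s Q \<notin> P"
        by metis
      \<comment> \<open>One multiplier outside P per component: their product stays outside P by
        primeness and moves z into every component, hence into x_i A.\<close>
      define t where "t = (\<Prod>Q\<in>\<Q> i. s Q)"
      have "(\<Prod>Q\<in>\<F>. s Q) \<notin> P" if "\<F> \<subseteq> \<Q> i" for \<F>
        using finite_subset[OF that \<Q>_finite] that
        by (induction \<F> rule: finite_induct) (use proper s prime in auto)
      then have "t \<notin> P"
        unfolding t_def by blast
      moreover have "t *s z \<in> Q" if "Q \<in> \<Q> i" for Q
      proof -
        have "t = (\<Prod>Q\<in>\<Q> i - {Q}. s Q) * s Q"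
          unfolding t_def using prod.remove[OF \<Q>_finite that, of s] by (simp add: mult.commute)
        then show ?thesis
          using submod_scale s[OF that] \<Q>_primary[OF that]
          unfolding primary_def by (metis scale_scale)
      qed
      then have "t *s z \<in> x i ` A"
        unfolding \<Q>_Inter using submod_scale[OF submod_carrier Cons.prems(1)] by blast
      ultimately show False
        using False by blast
    qed
    then obtain Q where Q: "Q \<in> \<Q> i" "\<And>s. s *s z \<in> Q \<Longrightarrow> s \<in> P"
      by blast
    have "P = radical Q"
    proof (intro set_eqI iffI)
      fix r assume "r \<in> P"
      then have "r *s z \<in> Q"
        using Cons.prems(2) ximage_Cons_subset x_image_subset[OF Q(1)] by blast
      moreover have "z \<notin> Q"
        using Q(2)[of 1] proper by auto
      ultimately show "r \<in> radical Q"
        using \<Q>_primary[OF Q(1)] Cons.prems(1) unfolding primary_def by blast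
    next
      fix r assume "r \<in> radical Q"
      then obtain e where "r ^ e \<in> P"
        using Q(2) Cons.prems(1) unfolding radical_def by blast
      then show "r \<in> P"
        using proper prime by (induction e) auto
    qed
    then show ?thesis
      unfolding primes_def using Q(1) by blast
  qed
qed

lemma exponent_bound:
  assumes J: "is_ideal J"
  shows "\<exists>e. \<forall>i. \<forall>Q\<in>\<Q> i. J \<subseteq> radical Q \<longrightarrow> smult_pow J e A \<subseteq> Q \<and> A \<subseteq> torsion J Q"
proof -
  let ?\<F> = "{Q \<in> (\<Union>i. \<Q> i). J \<subseteq> radical Q}"
  obtain S where S: "finite S" "J = ideal_gen S"
    using ideal_fg[OF J] by blast
  have "\<exists>e. smult_pow J e A \<subseteq> Q \<and> A \<subseteq> torsion J Q" if "Q \<in> ?\<F>" for Q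
    using fg_ideal_in_radical[OF _ _ S, of Q] \<Q>_primary that unfolding primary_def by blast
  then obtain E where E: "\<And>Q. Q \<in> ?\<F> \<Longrightarrow> smult_pow J (E Q) A \<subseteq> Q \<and> A \<subseteq> torsion J Q"
    by metis
  have "finite (E ` ?\<F>)"
    using \<Q>_finite by (intro finite_imageI finite_subset[of ?\<F> "\<Union>i. \<Q> i"]) auto
  then obtain e where e: "\<forall>a\<in>E ` ?\<F>. a \<le> e"
    using finite_nat_set_iff_bounded_le by blast
  have "smult_pow J e A \<subseteq> Q \<and> A \<subseteq> torsion J Q" if "Q \<in> ?\<F>" for Q
    using E[OF that] e that smult_pow_antimono[OF submod_carrier, of "E Q" e J] by blast
  then show ?thesis
    by blast
qed

text \<open>Components of x_i A whose radical contains J absorb J^e A; the others contain z because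
  it is torsion. So z lies in x_i A, Artin--Rees costs at most c powers of J, and x_i is
  cancelled.\<close>

lemma intersection_bound_fixed_ideal:
  assumes J: "is_ideal J"
  shows "\<exists>k. \<forall>is z. z \<in> smult_pow J (k * length is) A \<longrightarrow> z \<in> torsion J (ximage is) \<longrightarrow> z \<in> ximage is"
proof -
  obtain S where S: "finite S" "J = ideal_gen S"
    using ideal_fg[OF J] by blast
  obtain e where e: "\<And>i Q. Q \<in> \<Q> i \<Longrightarrow> J \<subseteq> radical Q \<Longrightarrow> smult_pow J e A \<subseteq> Q"
    using exponent_bound[OF J] by blast
  have "\<exists>c. \<forall>a\<ge>c. smult_pow J a A \<inter> x i ` A \<subseteq> smult_pow J (a - c) (x i ` A)" for i
    using artin_rees[OF S submod_image[OF x_op submod_carrier]] .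
  then obtain ci where ci: "\<And>i a. a \<ge> ci i \<Longrightarrow> smult_pow J a A \<inter> x i ` A \<subseteq> smult_pow J (a - ci i) (x i ` A)"
    by metis
  define c where "c = Max (range ci)"
  have c: "ci i \<le> c" for i
    unfolding c_def by simp
  define k where "k = c + e"
  have "z \<in> ximage is" if "z \<in> smult_pow J (k * length is) A" "z \<in> torsion J (ximage is)" for "is" z
    using that
  proof (induction "is" arbitrary: z)
    case (Cons i "is")
    let ?a = "k * length (i # is)"
    have zA: "z \<in> A"
      using Cons.prems(1) smult_pow_subset[OF submod_carrier] by blast
    have "z \<in> Q" if Q: "Q \<in> \<Q> i" for Q
    proof (cases "J \<subseteq> radical Q")
      case True
      have "e \<le> ?a"
        by (simp add: k_def)
      then show ?thesis
        using e[OF Q True] Cons.prems(1) smult_pow_antimono[OF submod_carrier] by blast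
    next
      case False
      then show ?thesis
        using torsion_primary[OF \<Q>_primary[OF Q] _ _ _ Cons.prems(2) zA]
          ximage_Cons_subset x_image_subset[OF Q] by blast
    qed
    then have "z \<in> x i ` A"
      unfolding \<Q>_Inter using zA by blast
    moreover have "ci i \<le> ?a"
      using c[of i] by (simp add: k_def)
    ultimately have "z \<in> smult_pow J (?a - ci i) (x i ` A)"
      using ci[of i ?a] Cons.prems(1) by blast
    \<comment> \<open>Each letter of the word provides k = c + e powers of J, which pays for the
      loss of \<open>ci i\<close>.\<close>
    moreover have "k * length is \<le> ?a - ci i"
      using c[of i] by (simp add: k_def)
    ultimately have "z \<in> smult_pow J (k * length is) (x i ` A)"
      using smult_pow_antimono[OF submod_image[OF x_op submod_carrier]] by blast
    then obtain w where w: "w \<in> smult_pow J (k * length is) A" "z = x i w"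
      using smult_pow_image[OF x_op submod_carrier] by blast
    have "w \<in> torsion J (ximage is)"
      using torsion_image_cancel[OF x_op x_inj, of i w J "ximage is"] Cons.prems(2) w(2) by simp
    then show ?case
      using Cons.IH[OF w(1)] w(2) by simp
  qed simp
  then show ?thesis
    by blast
qed

section \<open>One bound for all ideals J\<close>

definition prime_hull :: "'r set \<Rightarrow> 'r set" where
  "prime_hull J = \<Inter>{P \<in> primes. J \<subseteq> P}"

lemma is_ideal_primes: "P \<in> primes \<Longrightarrow> is_ideal P"
  unfolding primes_def using radical_ideal \<Q>_primary by blast

lemma is_ideal_prime_hull: "is_ideal (prime_hull J)"
  unfolding prime_hull_def by (rule is_ideal_Inter) (simp add: is_ideal_primes)

text \<open>With H the hull of J, z is first shown to be H-torsion modulo x_i A: a radical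
  containing J contains H, and the other components contain z. Descending along H-torsion reaches
  x_i A, where x_i is cancelled and the shorter word applies.\<close>

lemma torsion_prime_hull:
  assumes "z \<in> A" "z \<in> torsion J (ximage is)"
  shows "z \<in> torsion (prime_hull J) (ximage is)"
  using assms
proof (induction "is" arbitrary: z)
  case Nil
  then show ?case
    by (auto intro: torsion.base)
next
  case (Cons i "is")
  let ?H = "prime_hull J"
  have "z \<in> torsion ?H Q" if Q: "Q \<in> \<Q> i" for Q
  proof (cases "J \<subseteq> radical Q")
    case True
    then have "?H \<subseteq> radical Q"
      unfolding prime_hull_def primes_def using Q by blast
    then show ?thesis
      using exponent_bound[OF is_ideal_prime_hull[of J]] Q Cons.prems(1) by blast
  next
    case False
    then show ?thesis
      using torsion_primary[OF \<Q>_primary[OF Q] _ _ _ Cons.prems(2,1)]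
        ximage_Cons_subset x_image_subset[OF Q] torsion.base by blast
  qed
  then have "z \<in> torsion ?H (x i ` A)"
    unfolding \<Q>_Inter using Cons.prems(1) \<Q>_finite \<Q>_primary
    by (intro torsion_Inter) (auto simp: primary_def)
  then show ?case
    using Cons.prems(2)
  proof (induction rule: torsion.induct)
    case (base z)
    then obtain w where w: "w \<in> A" "z = x i w"
      by blast
    then have "w \<in> torsion J (ximage is)"
      using torsion_image_cancel[OF x_op x_inj, of i w J "ximage is"] base by simp
    then show ?case
      using torsion_image[OF x_op Cons.IH[OF w(1)], of i] w(2) by simp
  next
    case (step z)
    then show ?case
      using torsion_op[OF _ submod_ximage scale_op, of z J "i # is"] by (blast intro: torsion.step)
  qed
qed

text \<open>Passing from J to its hull enlarges J^a A and keeps torsion elements torsion, so the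
  largest constant over the finitely many hulls works for every J.\<close>

theorem intersection_bound:
  "\<exists>k. \<forall>J is z. z \<in> smult_pow J (k * length is) A \<longrightarrow> z \<in> torsion J (ximage is) \<longrightarrow> z \<in> ximage is"
proof -
  have "\<exists>k. \<forall>is z. z \<in> smult_pow H (k * length is) A \<longrightarrow> z \<in> torsion H (ximage is) \<longrightarrow> z \<in> ximage is"
    if "H \<in> range prime_hull" for H
    using that intersection_bound_fixed_ideal is_ideal_prime_hull by blast
  then obtain kf where kf: "\<And>H is z. H \<in> range prime_hull \<Longrightarrow> z \<in> smult_pow H (kf H * length is) A \<Longrightarrow>
      z \<in> torsion H (ximage is) \<Longrightarrow> z \<in> ximage is"
    by metis
  \<comment> \<open>A hull depends only on a subset of the finite set \<open>primes\<close>; the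
    empty subset gives the unit ideal.\<close>
  have "range prime_hull \<subseteq> Inter ` Pow primes"
    unfolding prime_hull_def by blast
  then have "finite (kf ` range prime_hull)"
    using finite_primes by (meson finite_Pow_iff finite_imageI finite_subset)
  then obtain k where k: "\<forall>a\<in>kf ` range prime_hull. a \<le> k"
    using finite_nat_set_iff_bounded_le by blast
  have "z \<in> ximage is" if z: "z \<in> smult_pow J (k * length is) A" "z \<in> torsion J (ximage is)" for J "is" z
  proof (rule kf[of "prime_hull J"])
    have "J \<subseteq> prime_hull J"
      unfolding prime_hull_def by blast
    then have "z \<in> smult_pow (prime_hull J) (k * length is) A"
      using z(1) smult_pow_mono by blast
    moreover have "kf (prime_hull J) * length is \<le> k * length is"
      using k by simp
    ultimately show "z \<in> smult_pow (prime_hull J) (kf (prime_hull J) * length is) A"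
      using smult_pow_antimono[OF submod_carrier] by blast
    show "z \<in> torsion (prime_hull J) (ximage is)"
      using torsion_prime_hull z smult_pow_subset[OF submod_carrier] by blast
  qed simp
  then show ?thesis
    by blast
qed

end

section \<open>Rees modules\<close>

context operator_module
begin

text \<open>Links powers of the ideal J with iterated multiplication of A by J.\<close>

lemma ideal_pow_scale: "r \<in> ideal_pow J k \<Longrightarrow> w \<in> A \<Longrightarrow> r *s w \<in> smult_pow J k A"
proof (induction k arbitrary: r)
  case 0
  then show ?case
    using submod_scale[OF submod_carrier] by simp
next
  case (Suc k)
  have r: "r \<in> ideal_gen {a * b | a b. a \<in> ideal_pow J k \<and> b \<in> J}"
    using Suc.prems(1) by (simp add: ideal_mult_def)
  show ?case
  proof (rule ideal_gen_scale_subset[OF submod_smult_pow[OF submod_carrier] _ r, where N = "{w}"])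
    fix s x assume "s \<in> {a * b | a b. a \<in> ideal_pow J k \<and> b \<in> J}" "x \<in> {w}"
    then obtain a b where *: "s = a * b" "a \<in> ideal_pow J k" "b \<in> J" "x = w"
      by blast
    then have "b *s (a *s w) \<in> smult_pow J (Suc k) A"
      using ideal_smult_base[OF _ Suc.IH[OF _ Suc.prems(2)]] by simp
    then show "s *s x \<in> smult_pow J (Suc k) A"
      using * by (simp add: mult.commute)
  qed simp
qed

lemma torsionI_ideal_pow: "(\<And>r. r \<in> ideal_pow J l \<Longrightarrow> r *s z \<in> N) \<Longrightarrow> z \<in> torsion J N"
proof (induction l arbitrary: z)
  case 0
  then show ?case
    using torsion.base[of z N J] 0[of 1] by simp
next
  case (Suc l)
  show ?case
  proof (rule torsion.step, rule Suc.IH)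
    fix s r assume "s \<in> J" "r \<in> ideal_pow J l"
    then have "r * s \<in> ideal_pow J (Suc l)"
      using subset_ideal_gen by (force simp: ideal_mult_def)
    then show "r *s (s *s z) \<in> N"
      using Suc.prems by simp
  qed
qed

end

context multi_filtered_module
begin

lemma ximage_foldr: "ximage is = foldr x is ` A"
  by (induction "is") (auto simp: image_comp)

end

section \<open>Shifts by monomials, and homogeneous elements of the Rees module\<close>

lemma hom_smult_hom_smult:
  assumes "module scale"
  shows "hom_smult scale a d (hom_smult scale b e f) = hom_smult scale (a * b) (vadd d e) f"
proof -
  interpret module scale by fact
  have "vsub (vsub n d) e = vsub n (vadd d e)" for n
    by (auto simp: vsub_def vadd_def)
  then show ?thesis
    by (simp add: hom_smult_def)
qed

text \<open>T^-n is a word of length |n| in the T_i^-1, by induction on |n| removing a unit from a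
  positive coordinate. The length turns the bound k * \<open>length is\<close> into k|n|.\<close>

lemma foldr_shift:
  fixes scale :: "'r::comm_ring_1 \<Rightarrow> 'm::ab_group_add \<Rightarrow> 'm" and n :: "'t::finite \<Rightarrow> int"
  assumes scale: "module scale" and "in_Nt n"
  shows "\<exists>is. length is = nat (vnorm n) \<and>
    foldr (\<lambda>i. hom_smult scale 1 (neg_unit i)) is = hom_smult scale 1 (\<lambda>j. - n j)"
  using \<open>in_Nt n\<close>
proof (induction "nat (vnorm n)" arbitrary: n)
  case 0
  have "0 \<le> n j" for j
    using 0 by (simp add: in_Nt_def)
  moreover have "(\<Sum>j\<in>UNIV. n j) \<le> 0"
    using 0 by (simp add: vnorm_def)
  ultimately have "n j = 0" for j
    using sum_nonneg_eq_0_iff[of UNIV n] sum_nonneg[of UNIV n] by simp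
  then have "hom_smult scale 1 (\<lambda>j. - n j) = id"
    by (auto simp: hom_smult_def vsub_def module.scale_one[OF scale])
  then show ?case
    using 0 by (intro exI[of _ "[]"]) auto
next
  case (Suc l)
  have "\<exists>i. n i > 0"
  proof (rule ccontr)
    assume "\<not> ?thesis"
    then have "vnorm n \<le> 0"
      unfolding vnorm_def by (intro sum_nonpos) (auto simp: not_less)
    then show False
      using Suc by simp
  qed
  then obtain i where i: "n i > 0"
    by blast
  define n' where "n' = vadd n (neg_unit i)"
  have n'_eq: "n' j = n j - (if j = i then 1 else 0)" for j
    by (simp add: n'_def vadd_def neg_unit_def)
  have "vnorm n' = vnorm n - 1"
    unfolding vnorm_def n'_eq by (simp add: sum_subtractf)
  then have l: "l = nat (vnorm n')"
    using Suc.hyps(2) by linarith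
  have "in_Nt n'"
    using Suc.prems i by (simp add: in_Nt_def n'_eq)
  then obtain js where js: "length js = nat (vnorm n')"
    "foldr (\<lambda>i. hom_smult scale 1 (neg_unit i)) js = hom_smult scale 1 (\<lambda>j. - n' j)"
    using Suc.hyps(1)[OF l] by blast
  have "vadd (neg_unit i) (\<lambda>j. - n' j) = (\<lambda>j. - n j)"
    by (auto simp: vadd_def neg_unit_def n'_eq)
  then have "foldr (\<lambda>i. hom_smult scale 1 (neg_unit i)) (i # js) = hom_smult scale 1 (\<lambda>j. - n j)"
    by (auto simp: js(2) hom_smult_hom_smult[OF scale])
  moreover have "length (i # js) = nat (vnorm n)"
    using js(1) l Suc.hyps(2) by simp
  ultimately show ?case
    by blast
qed

lemma single_in_rees_mod_elems_iff:
  assumes "\<And>n. 0 \<in> Mf n"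
  shows "(\<lambda>n. if n = m then z else 0) \<in> rees_mod_elems Mf \<longleftrightarrow> z \<in> Mf m"
  using assms unfolding rees_mod_elems_def by (auto simp: if_distrib cong: if_cong)

text \<open>T^-n carries degree m + n to degree m, so the degree-m component of T^-n times the Rees
  module is M_(m+n).\<close>

lemma single_in_shift_iff:
  assumes "module scale" "\<And>n. 0 \<in> Mf n"
  shows "(\<lambda>k. if k = m then z else 0) \<in> hom_smult scale 1 (\<lambda>j. - n j) ` rees_mod_elems Mf
    \<longleftrightarrow> z \<in> Mf (vadd m n)"
proof -
  interpret module scale by fact
  have shift: "hom_smult scale 1 (\<lambda>j. - n j) f = (\<lambda>k. f (vadd k n))" for f
    by (simp add: hom_smult_def vsub_def vadd_def)
  show ?thesis
  proof
    assume "(\<lambda>k. if k = m then z else 0) \<in> hom_smult scale 1 (\<lambda>j. - n j) ` rees_mod_elems Mf"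
    then obtain f where f: "f \<in> rees_mod_elems Mf" "(\<lambda>k. if k = m then z else 0) = (\<lambda>k. f (vadd k n))"
      unfolding shift by blast
    have "z = f (vadd m n)"
      using fun_cong[OF f(2), of m] by simp
    then show "z \<in> Mf (vadd m n)"
      using f(1) unfolding rees_mod_elems_def by blast
  next
    assume "z \<in> Mf (vadd m n)"
    then have mem: "(\<lambda>k. if k = vadd m n then z else 0) \<in> rees_mod_elems Mf"
      using single_in_rees_mod_elems_iff[of Mf] assms(2) by blast
    have "vadd k n = vadd m n \<longleftrightarrow> k = m" for k
      by (auto simp: vadd_def fun_eq_iff)
    then have eq: "hom_smult scale 1 (\<lambda>j. - n j) (\<lambda>k. if k = vadd m n then z else 0) = (\<lambda>k. if k = m then z else 0)"
      unfolding shift by simp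
    show "(\<lambda>k. if k = m then z else 0) \<in> hom_smult scale 1 (\<lambda>j. - n j) ` rees_mod_elems Mf"
      using imageI[OF mem, of "hom_smult scale 1 (\<lambda>j. - n j)"] unfolding eq .
  qed
qed

text \<open>The union of a chain is a Rees submodule; its finitely many generators already lie in
  one member, where the chain stops. Scalars are the homogeneous elements of degree zero.\<close>

lemma operator_module_rees:
  fixes scale :: "'r::comm_ring_1 \<Rightarrow> 'm::ab_group_add \<Rightarrow> 'm"
    and Mf :: "('t::finite \<Rightarrow> int) \<Rightarrow> 'm set"
  assumes scale: "module scale" and sub: "\<And>n. module.subspace scale (Mf n)"
    and I: "graded_rees_ring I" "\<And>d n a x. a \<in> I d \<Longrightarrow> x \<in> Mf n \<Longrightarrow> scale a x \<in> Mf (vadd d n)"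
    and fg: "\<And>N. rees_submod scale I Mf N \<Longrightarrow> \<exists>G. finite G \<and> G \<subseteq> N \<and> rees_span scale I Mf G = N"
  shows "operator_module (\<lambda>r f n. scale r (f n)) {hom_smult scale a d | a d. a \<in> I d} (rees_mod_elems Mf)"
    (is "operator_module ?sc ?\<Omega> ?A")
proof -
  interpret module scale by fact
  have I0: "a \<in> I (\<lambda>_. 0)" for a
    using I(1) unfolding graded_rees_ring_def by blast
  have sc: "?sc r = hom_smult scale r (\<lambda>_. 0)" for r
    by (auto simp: hom_smult_def vsub_def)
  have A: "submod ?\<Omega> ?A"
  proof (rule submodI)
    show "0 \<in> ?A"
      unfolding rees_mod_elems_def using subspace_0[OF sub] by simp
  next
    fix f g assume fg: "f \<in> ?A" "g \<in> ?A"
    have "{n. (f - g) n \<noteq> 0} \<subseteq> {n. f n \<noteq> 0} \<union> {n. g n \<noteq> 0}"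
      by auto
    then have "finite {n. (f - g) n \<noteq> 0}"
      using fg unfolding rees_mod_elems_def by (auto intro: finite_subset)
    then show "f - g \<in> ?A"
      using fg subspace_diff[OF sub] unfolding rees_mod_elems_def by simp
  next
    fix h f assume "h \<in> ?\<Omega>" and f: "f \<in> ?A"
    then obtain a d where h: "h = hom_smult scale a d" "a \<in> I d"
      by blast
    have d: "vadd d (vsub n d) = n" "vsub (vadd d n) d = n" for n
      by (auto simp: vadd_def vsub_def)
    have "{n. h f n \<noteq> 0} \<subseteq> vadd d ` {n. f n \<noteq> 0}"
    proof
      fix n assume "n \<in> {n. h f n \<noteq> 0}"
      then have "f (vsub n d) \<noteq> 0"
        unfolding h hom_smult_def by auto
      then show "n \<in> vadd d ` {n. f n \<noteq> 0}"
        using d(1)[of n] by (metis (mono_tags, lifting) imageI mem_Collect_eq)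
    qed
    then have "finite {n. h f n \<noteq> 0}"
      using f unfolding rees_mod_elems_def by (auto intro: finite_subset)
    moreover have "h f n \<in> Mf n" for n
      using I(2)[OF h(2), of "f (vsub n d)" "vsub n d"] f
      unfolding h(1) hom_smult_def rees_mod_elems_def by (simp add: d)
    ultimately show "h f \<in> ?A"
      unfolding rees_mod_elems_def by blast
  qed
  have rees: "rees_submod scale I Mf N" if N: "submod ?\<Omega> N" "N \<subseteq> ?A" for N
    unfolding rees_submod_def
  proof (intro conjI ballI allI)
    show "(\<lambda>_. 0) \<in> N"
      using submod_zero[OF N(1)] by (simp add: zero_fun_def)
    show "(\<lambda>n. f n + g n) \<in> N" if "f \<in> N" "g \<in> N" for f g
      using submod_add[OF N(1) that] by (simp add: plus_fun_def)
    show "hom_smult scale a d f \<in> N" if "a \<in> I d" "f \<in> N" for a d f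
      using submod_op[OF N(1) _ that(2)] that(1) by blast
  qed (use N in blast)
  have noeth: "noetherian ?\<Omega> ?A"
    unfolding noetherian_def
  proof (intro conjI allI impI)
    show "submod ?\<Omega> ?A"
      using A .
    fix F :: "nat \<Rightarrow> (('t \<Rightarrow> int) \<Rightarrow> 'm) set"
    assume F: "\<forall>i. submod ?\<Omega> (F i) \<and> F i \<subseteq> ?A" and "mono F"
    have "submod ?\<Omega> (\<Union>i. F i)"
    proof (rule submodI)
      show "0 \<in> (\<Union>i. F i)"
        using F submod_zero by blast
      show "f x \<in> (\<Union>i. F i)" if "f \<in> ?\<Omega>" "x \<in> (\<Union>i. F i)" for f x
        using F that submod_op by (metis (no_types, lifting) UN_iff)
      show "x - y \<in> (\<Union>i. F i)" if "x \<in> (\<Union>i. F i)" "y \<in> (\<Union>i. F i)" for x y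
      proof -
        obtain i j where "x \<in> F i" "y \<in> F j"
          using \<open>x \<in> (\<Union>i. F i)\<close> \<open>y \<in> (\<Union>i. F i)\<close> by blast
        then have "x \<in> F (max i j)" "y \<in> F (max i j)"
          using monoD[OF \<open>mono F\<close>, of i "max i j"] monoD[OF \<open>mono F\<close>, of j "max i j"] by auto
        then show ?thesis
          using F submod_diff[of ?\<Omega> "F (max i j)" x y] by blast
      qed
    qed
    then have "rees_submod scale I Mf (\<Union>i. F i)"
      by (rule rees) (use F in blast)
    from fg[OF this] obtain G
      where G: "finite G" "G \<subseteq> (\<Union>i. F i)" "rees_span scale I Mf G = (\<Union>i. F i)"
      by blast
    have "\<exists>k. G \<subseteq> F k"
      using G(1,2)
    proof (induction G rule: finite_induct)
      case (insert g G)
      then obtain i j where "g \<in> F i" "G \<subseteq> F j"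
        by blast
      then have "insert g G \<subseteq> F (max i j)"
        using monoD[OF \<open>mono F\<close>, of i "max i j"] monoD[OF \<open>mono F\<close>, of j "max i j"] by auto
      then show ?case
        by blast
    qed simp
    then obtain k where k: "G \<subseteq> F k"
      by blast
    have "rees_submod scale I Mf (F k)"
      by (rule rees) (use F in blast)+
    then have "(\<Union>i. F i) \<subseteq> F k"
      unfolding G(3)[symmetric] rees_span_def using k by blast
    then show "\<exists>k. \<forall>i\<ge>k. F i = F k"
      using monoD[OF \<open>mono F\<close>] by (intro exI[of _ k]) blast
  qed
  have sc_module: "module ?sc"
    by unfold_locales (auto simp: scale_right_distrib scale_left_distrib)
  show ?thesis
  proof (intro operator_module.intro operator_module_axioms.intro)
    show "additive f" if "f \<in> ?\<Omega>" for f
      using that by (auto simp: additive_def hom_smult_def scale_right_distrib)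
    show "f (g y) = g (f y)" if "f \<in> ?\<Omega>" "g \<in> ?\<Omega>" for f g y
    proof -
      have "vadd d e = vadd e d" for d e :: "'t \<Rightarrow> int"
        by (simp add: vadd_def add.commute)
      then show ?thesis
        using that by (auto simp: hom_smult_hom_smult[OF scale] mult.commute)
    qed
    show "?sc r \<in> ?\<Omega>" for r
      unfolding sc using I0 by blast
  qed (fact sc_module noeth)+
qed

section \<open>Transfer from the Rees module back to the filtration, degree by degree\<close>

theorem theorem3p5:
  fixes scale :: "'r::comm_ring_1 \<Rightarrow> 'm::ab_group_add \<Rightarrow> 'm"
    and Mf :: "('t::finite \<Rightarrow> int) \<Rightarrow> 'm set"
  assumes "module scale"
    and "noetherian_ring TYPE('r)"
    and "fin_gen_module scale"
    and "noetherian_filtration scale Mf"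
  shows "(\<exists>k::nat. \<forall>m n (J::'r set). in_Nt n \<longrightarrow> is_ideal J \<longrightarrow>
            ideal_smult scale (ideal_pow J (k * nat (vnorm n))) (Mf m)
              \<inter> sat_colon scale (Mf (vadd m n)) (Mf m) J
            \<subseteq> Mf (vadd m n))
       \<and> finite (\<Union>{Ass_quot scale (Mf m) (Mf (vadd m n)) | m n. in_Nt n})"
proof -
  interpret module scale by fact
  have sub: "subspace (Mf n)" for n
    using assms(4) by (simp add: noetherian_filtration_def)
  from assms(4)[unfolded noetherian_filtration_def, THEN conjunct2] obtain I
    where "graded_rees_ring I \<and> (\<forall>d n. \<forall>a\<in>I d. \<forall>x\<in>Mf n. scale a x \<in> Mf (vadd d n)) \<and>
      (\<forall>N. rees_submod scale I Mf N \<longrightarrow> (\<exists>G. finite G \<and> G \<subseteq> N \<and> rees_span scale I Mf G = N))"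
    by (rule exE)
  then have I: "graded_rees_ring I"
    "\<And>d n a x. a \<in> I d \<Longrightarrow> x \<in> Mf n \<Longrightarrow> scale a x \<in> Mf (vadd d n)"
    "\<And>N. rees_submod scale I Mf N \<Longrightarrow> \<exists>G. finite G \<and> G \<subseteq> N \<and> rees_span scale I Mf G = N"
    by simp_all
  define sc :: "'r \<Rightarrow> (('t \<Rightarrow> int) \<Rightarrow> 'm) \<Rightarrow> (('t \<Rightarrow> int) \<Rightarrow> 'm)" where "sc r f = (\<lambda>n. scale r (f n))" for r f
  define \<Omega> where "\<Omega> = {hom_smult scale a d | a d. a \<in> I d}"
  define A where "A = rees_mod_elems Mf"
  define x where "x i = hom_smult scale 1 (neg_unit i)" for i :: 't
  interpret rees: operator_module sc \<Omega> A
    unfolding sc_def[abs_def] \<Omega>_def A_def using operator_module_rees[OF assms(1) sub I] .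
  have x_op: "x i \<in> \<Omega>" for i
    using I(1) unfolding \<Omega>_def x_def graded_rees_ring_def by blast
  have x_inj: "inj (x i)" for i
  proof (rule injI)
    fix f g assume "x i f = x i g"
    then have "f (vsub n (neg_unit i)) = g (vsub n (neg_unit i))" for n
      unfolding x_def hom_smult_def by (simp add: fun_eq_iff)
    moreover have "vsub (vadd n (neg_unit i)) (neg_unit i) = n" for n
      by (simp add: vsub_def vadd_def)
    ultimately show "f = g"
      by (metis ext)
  qed
  have "\<exists>\<Q>. finite \<Q> \<and> (\<forall>Q\<in>\<Q>. rees.primary Q) \<and> x i ` A = A \<inter> \<Inter>\<Q>" for i
    by (rule rees.primary_decomposition[OF rees.submod_image[OF x_op rees.submod_carrier]])
      (use submod_op[OF rees.submod_carrier x_op] in blast)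
  then obtain \<Q> where \<Q>: "\<And>i. finite (\<Q> i) \<and> (\<forall>Q\<in>\<Q> i. rees.primary Q) \<and> x i ` A = A \<inter> \<Inter>(\<Q> i)"
    by metis
  interpret rees: multi_filtered_module sc \<Omega> A x \<Q>
    using assms(2) x_op x_inj \<Q> by unfold_locales blast+
  \<comment> \<open>The homogeneous element z T^m, through which statements about M_m become
    statements about A.\<close>
  define at where "at m z = (\<lambda>k::'t \<Rightarrow> int. if k = m then z else 0)" for m and z :: 'm
  have at_A: "at m z \<in> A \<longleftrightarrow> z \<in> Mf m" for m z
    unfolding at_def A_def using single_in_rees_mod_elems_iff[of Mf] subspace_0[OF sub] by blast
  have sc_at: "sc r (at m z) = at m (scale r z)" for r m z
    by (auto simp: sc_def at_def)
  have shift: "\<exists>is. length is = nat (vnorm n) \<and> (\<forall>m z. at m z \<in> rees.ximage is \<longleftrightarrow> z \<in> Mf (vadd m n))"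
    if n: "in_Nt n" for n
  proof -
    obtain "is" where "is": "length is = nat (vnorm n)" "foldr x is = hom_smult scale 1 (\<lambda>j. - n j)"
      using foldr_shift[OF assms(1) n] unfolding x_def[abs_def] by blast
    have "at m z \<in> rees.ximage is \<longleftrightarrow> z \<in> Mf (vadd m n)" for m z
      unfolding rees.ximage_foldr "is"(2) unfolding at_def A_def
      using single_in_shift_iff[of scale Mf, OF assms(1) subspace_0[OF sub]] .
    then show ?thesis
      using "is"(1) by blast
  qed
  obtain k where k: "\<And>J is z. z \<in> rees.smult_pow J (k * length is) A \<Longrightarrow>
      z \<in> rees.torsion J (rees.ximage is) \<Longrightarrow> z \<in> rees.ximage is"
    using rees.intersection_bound by blast
  have "z \<in> Mf (vadd m n)"
    if n: "in_Nt n" and z: "z \<in> ideal_smult scale (ideal_pow J (k * nat (vnorm n))) (Mf m)"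
      "z \<in> sat_colon scale (Mf (vadd m n)) (Mf m) J" for m n z and J :: "'r set"
  proof -
    obtain "is" where "is": "length is = nat (vnorm n)" "\<And>m z. at m z \<in> rees.ximage is \<longleftrightarrow> z \<in> Mf (vadd m n)"
      using shift[OF n] by blast
    let ?W = "rees.smult_pow J (k * length is) A"
    have W: "submod \<Omega> ?W"
      using rees.submod_smult_pow[OF rees.submod_carrier] .
    \<comment> \<open>The left-hand factor of the intersection is a span, so membership in
      \<open>?W\<close> need only be checked on products r y.\<close>
    have "subspace {z. at m z \<in> ?W}"
    proof (rule subspaceI)
      have "at m 0 = 0" "\<And>u v. at m (u + v) = at m u + at m v"
        by (auto simp: at_def)
      then show "0 \<in> {z. at m z \<in> ?W}"
        "\<And>u v. u \<in> {z. at m z \<in> ?W} \<Longrightarrow> v \<in> {z. at m z \<in> ?W} \<Longrightarrow> u + v \<in> {z. at m z \<in> ?W}"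
        using submod_zero[OF W] submod_add[OF W] by auto
      show "scale c u \<in> {z. at m z \<in> ?W}" if "u \<in> {z. at m z \<in> ?W}" for c u
        using rees.submod_scale[OF W, of "at m u" c] that by (simp add: sc_at)
    qed
    moreover have "at m (scale r y) \<in> ?W" if "r \<in> ideal_pow J (k * length is)" "y \<in> Mf m" for r y
      using rees.ideal_pow_scale[OF that(1), of "at m y"] that(2) by (simp add: sc_at at_A)
    ultimately have "ideal_smult scale (ideal_pow J (k * length is)) (Mf m) \<subseteq> {z. at m z \<in> ?W}"
      unfolding ideal_smult_def by (intro span_minimal) auto
    then have "at m z \<in> ?W"
      using z(1) "is"(1) by auto
    moreover obtain l where "\<forall>r\<in>ideal_pow J l. scale r z \<in> Mf (vadd m n)"
      using z(2) unfolding sat_colon_def by blast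
    then have "at m z \<in> rees.torsion J (rees.ximage is)"
      by (intro rees.torsionI_ideal_pow[of J l]) (simp add: sc_at "is"(2))
    ultimately show ?thesis
      using k "is"(2) by blast
  qed
  moreover have "Ass_quot scale (Mf m) (Mf (vadd m n)) \<subseteq> rees.primes" if n: "in_Nt n" for m n
  proof
    fix P assume "P \<in> Ass_quot scale (Mf m) (Mf (vadd m n))"
    then obtain y where y: "prime_ideal P" "y \<in> Mf m" "P = {r. scale r y \<in> Mf (vadd m n)}"
      unfolding Ass_quot_def by blast
    obtain "is" where "is": "\<And>m z. at m z \<in> rees.ximage is \<longleftrightarrow> z \<in> Mf (vadd m n)"
      using shift[OF n] by blast
    show "P \<in> rees.primes"
      using y by (intro rees.associated_prime_in_primes[of P "at m y" "is"]) (simp_all add: at_A sc_at "is")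
  qed
  then have "finite (\<Union>{Ass_quot scale (Mf m) (Mf (vadd m n)) | m n. in_Nt n})"
    by (intro finite_subset[OF _ rees.finite_primes]) blast
  ultimately show ?thesis
    by blast
qed

end
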